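(* Let $n,k$ be integers with $4\le k\le n-1$, and let $\mathcal X\subset\mathbb R^2$ be an $n$-independent set of nodes with $\#\mathcal X=d(n,k-3)+3$. Then there are at most seven linearly independent polynomials in $\Pi_k$ vanishing at all nodes of $\mathcal X$ (i.e. $\dim\{p\in\Pi_k: p|_{\mathcal X}=0\}\le 7$). Moreover, there are seven such linearly independent polynomials if and only if all the nodes of $\mathcal X$ but three lie in a curve of degree $k-3$ (which is then a maximal curve for $\mathcal X$).
   Context: $\Pi_n$ denotes the space of real bivariate polynomials of total degree at most $n$; $N_n=\dim\Pi_n=\frac12(n+1)(n+2)$, and $d(n,k):=N_n-N_{n-k}=\frac12 k(2n+3-k)$. A curve of degree $k$ is identified with a polynomial $p$ of degree $k$ (the curve being $\{p=0\}$); a curve passes through a node if the polynomial vanishes there, and "linearly independent curves" means linearly independent polynomials. For a finite node set $\mathcal X$ and $A\in\mathcal X$, a polynomial $p\in\Pi_n$ is an $n$-fundamental polynomial of $A$ if $p(A)=1$ and $p$ vanishes on $\mathcal X\setminus\{A\}$. $\mathcal X$ is $n$-independent if every node of $\mathcal X$ has an $n$-fundamental polynomial. Given an $n$-independent set $\mathcal X$ with $\#\mathcal X\ge d(n,k)$, a curve of degree $k\le n$ is called maximal if it passes through exactly $d(n,k)$ nodes of $\mathcal X$. *)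

theory Defs
  imports Complex_Main
begin

text \<open>Real bivariate polynomials are represented by their coefficient functions:
  c (i,j) is the coefficient of the monomial x^i y^j.  Only finitely supported
  coefficient functions occur (all polynomials considered lie in some Pi n).\<close>

type_synonym bipoly = "nat \<times> nat \<Rightarrow> real"

definition Pi_deg :: "nat \<Rightarrow> bipoly set" where
  "Pi_deg n = {c. \<forall>i j. c (i, j) \<noteq> 0 \<longrightarrow> i + j \<le> n}"

definition peval :: "bipoly \<Rightarrow> real \<times> real \<Rightarrow> real" where
  "peval c P = (\<Sum>ij\<in>{ij. c ij \<noteq> 0}. c ij * fst P ^ fst ij * snd P ^ snd ij)"

definition total_degree :: "bipoly \<Rightarrow> nat" where
  "total_degree c = Max {i + j |i j. c (i, j) \<noteq> 0}"

text \<open>d(n,k) = N_n - N_{n-k} = k(2n+3-k)/2.\<close>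
definition d_nk :: "nat \<Rightarrow> nat \<Rightarrow> nat" where
  "d_nk n k = (k * (2 * n + 3 - k)) div 2"

definition fundamental :: "nat \<Rightarrow> (real \<times> real) set \<Rightarrow> real \<times> real \<Rightarrow> bipoly \<Rightarrow> bool" where
  "fundamental n X A p \<longleftrightarrow> p \<in> Pi_deg n \<and> peval p A = 1 \<and> (\<forall>B\<in>X - {A}. peval p B = 0)"

definition n_independent :: "nat \<Rightarrow> (real \<times> real) set \<Rightarrow> bool" where
  "n_independent n X \<longleftrightarrow> (\<forall>A\<in>X. \<exists>p. fundamental n X A p)"

definition lin_indep :: "bipoly set \<Rightarrow> bool" where
  "lin_indep S \<longleftrightarrow> (\<forall>u. (\<forall>ij. (\<Sum>p\<in>S. u p * p ij) = 0) \<longrightarrow> (\<forall>p\<in>S. u p = 0))"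

definition vanishing :: "nat \<Rightarrow> (real \<times> real) set \<Rightarrow> bipoly set" where
  "vanishing k X = {p \<in> Pi_deg k. \<forall>A\<in>X. peval p A = 0}"

end

theory Submission
  imports Defs "HOL-Library.Nat_Bijection" "HOL-Computational_Algebra.Polynomial_Factorial"
begin

text \<open>
  Order the monomials $x^i y^j$ by total degree and then by $i$. The dimension of a space of
  polynomials is the number of its leading monomials. Let $e_m$ be the number of leading monomials of
  degree $m$ in the vanishing ideal of $X$. They are stable under multiplication by $x$ and $y$, so
  $e_{m+1} > e_m$ as soon as $e_m > 0$. By independence $e_0 + \dots + e_n = N_{n-k+3} - 3$, and counting
  gives $e_0 + \dots + e_k \le 7$, with equality only if $e_{k+1} = 5$, $e_k = 4$ and either
  $e_{k-1} = 3$ or $(e_{k-2}, e_{k-1}) = (1, 2)$ (all earlier ones being $0$).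

  In the first case the three polynomials of degree $k - 1$ satisfy two linear syzygies; they are
  proportional to the three $2 \times 2$ minors, which are conics, two of them with coprime leading forms,
  so a factor $q$ of degree $k - 3$ splits off.
  In the second case the polynomial $f$ of degree $k - 2$ and a polynomial $p$ of degree $k$ outside the
  multiples of $f$ satisfy a relation $l p = f c$ with $l$ linear; hence $f = l q$.
  In both cases $q$ divides every polynomial of degree $k$ vanishing on $X$. Independence puts at most
  $d(n, k - 3)$ nodes on $q$, and four nodes off $q$ would leave at most six cubic cofactors.
\<close>

section \<open>Coefficients, evaluation and leading monomials\<close>

text \<open>The outer variable of a \<open>real poly poly\<close> is $x$, the inner one is $y$.\<close>

definition cf :: "real poly poly \<Rightarrow> bipoly" where
  "cf p = (\<lambda>(i, j). coeff (coeff p i) j)"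

definition ev :: "real poly poly \<Rightarrow> real \<times> real \<Rightarrow> real" where
  "ev p A = poly (poly p [:fst A:]) (snd A)"

definition scal :: "real \<Rightarrow> real poly poly \<Rightarrow> real poly poly" where
  "scal r p = smult [:r:] p"

lemma cf_simps [simp]:
  "cf 0 ij = 0"
  "cf (p + q) ij = cf p ij + cf q ij"
  "cf (p - q) ij = cf p ij - cf q ij"
  "cf (scal r p) ij = r * cf p ij"
  by (auto simp: cf_def scal_def split: prod.split)

lemma cf_sum [simp]: "cf (sum f S) ij = (\<Sum>s\<in>S. cf (f s) ij)"
  by (induction S rule: infinite_finite_induct) auto

lemma cf_eq_iff: "cf p = cf q \<longleftrightarrow> p = q"
  by (auto simp: cf_def fun_eq_iff poly_eq_iff)

lemma ev_simps [simp]: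
  "ev 0 A = 0"
  "ev (p + q) A = ev p A + ev q A"
  "ev (p - q) A = ev p A - ev q A"
  "ev (p * q) A = ev p A * ev q A"
  "ev (scal r p) A = r * ev p A"
  by (auto simp: ev_def scal_def)

interpretation bp: vector_space scal
  by standard (auto simp: scal_def smult_add_right smult_add_left [symmetric] mult.commute
      one_pCons [symmetric])

lemma scal_mult_left [simp]: "scal r p * q = scal r (p * q)"
  and scal_mult_right [simp]: "p * scal r q = scal r (p * q)"
  by (auto simp: scal_def)

text \<open>The diagonal \<open>i + j = s\<close> occupies the codes from \<open>triangle s\<close>
  to \<open>triangle s + s\<close>, and these blocks follow one another.\<close>

lemma prod_encode_less_iff:
  "prod_encode (i, j) < prod_encode (i', j') \<longleftrightarrow> i + j < i' + j' \<or> i + j = i' + j' \<and> i < i'"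
proof -
  have *: "prod_encode (i, j) < prod_encode (i', j')" if "i + j < i' + j'" for i j i' j'
  proof -
    have "mono triangle"
      by (rule mono_iff_le_Suc [THEN iffD2]) simp
    then have "triangle (Suc (i + j)) \<le> triangle (i' + j')"
      using that by (intro monoD[of triangle]) auto
    then show ?thesis by (simp add: prod_encode_def)
  qed
  show ?thesis
    using *[of i j i' j'] *[of i' j' i j]
    by (cases "i + j" "i' + j'" rule: linorder_cases) (auto simp: prod_encode_def)
qed

lemma prod_encode_less_triangle_iff: "prod_encode (i, j) < triangle (Suc m) \<longleftrightarrow> i + j \<le> m"
  using prod_encode_less_iff[of i j 0 "Suc m"] by (simp add: prod_encode_def less_Suc_eq_le)

declare triangle_Suc [simp del]

text \<open>The pairing function \<open>prod_encode (i, j) = triangle (i + j) + i\<close> lists the monomials in increasing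
  order, so \<open>below (triangle (Suc m))\<close> is $\Pi_m$ and \<open>leads V\<close> is the set of (indices of) leading
  monomials of \<open>V\<close>.\<close>

definition below :: "nat \<Rightarrow> real poly poly set" where
  "below N = {p. \<forall>ij. N \<le> prod_encode ij \<longrightarrow> cf p ij = 0}"

definition leads :: "real poly poly set \<Rightarrow> nat set" where
  "leads V = {l. \<exists>p\<in>V. p \<in> below (Suc l) \<and> cf p (prod_decode l) \<noteq> 0}"

lemma belowD: "p \<in> below N \<Longrightarrow> N \<le> prod_encode ij \<Longrightarrow> cf p ij = 0"
  unfolding below_def by blast

lemma subspace_below: "bp.subspace (below N)"
  by (auto simp: bp.subspace_def below_def)

lemma below_mono: "M \<le> N \<Longrightarrow> below M \<subseteq> below N"
  by (auto simp: below_def)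

lemma below_SucD: "p \<in> below (Suc l) \<Longrightarrow> cf p (prod_decode l) = 0 \<Longrightarrow> p \<in> below l"
  unfolding below_def
  by clarify (metis Suc_leI le_neq_implies_less prod_encode_inverse surj_pair)

lemma below_0: "below 0 = {0}"
  using cf_eq_iff[of _ 0] by (auto simp: below_def fun_eq_iff)

lemma below_triangle_iff: "p \<in> below (triangle (Suc m)) \<longleftrightarrow> cf p \<in> Pi_deg m"
  unfolding below_def Pi_deg_def
  by (auto simp: prod_encode_less_triangle_iff not_less[symmetric])

lemma ex_cf_of_Pi_deg:
  assumes "c \<in> Pi_deg m"
  obtains p where "cf p = c"
proof
  let ?p = "\<Sum>i\<le>m. monom (\<Sum>j\<le>m. monom (c (i, j)) j) i"
  have "cf ?p (i, j) = c (i, j)" for i j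
  proof -
    have "cf ?p (i, j) = (\<Sum>i'\<le>m. if i' = i then (\<Sum>j'\<le>m. if j' = j then c (i, j) else 0) else 0)"
      unfolding cf_sum by (intro sum.cong) (auto simp: cf_def coeff_sum)
    also have "\<dots> = c (i, j)"
      using assms by (auto simp: Pi_deg_def) (metis add_leE)+
    finally show ?thesis .
  qed
  then show "cf ?p = c" by auto
qed

lemma finite_support_cf: "finite {ij. cf p ij \<noteq> 0}"
proof (rule finite_subset)
  show "{ij. cf p ij \<noteq> 0} \<subseteq> (SIGMA i:{..degree p}. {..degree (coeff p i)})"
    by (auto simp: cf_def intro!: le_degree)
qed auto

lemma ex_below: obtains m where "p \<in> below (triangle (Suc m))"
proof -
  have "finite ((\<lambda>ij. fst ij + snd ij) ` {ij. cf p ij \<noteq> 0})"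
    using finite_support_cf by auto
  then obtain m where "\<forall>s\<in>(\<lambda>ij. fst ij + snd ij) ` {ij. cf p ij \<noteq> 0}. s \<le> m"
    using finite_nat_set_iff_bounded_le by metis
  then have "cf p \<in> Pi_deg m" by (auto simp: Pi_deg_def)
  then show thesis using that below_triangle_iff by blast
qed

lemma ev_eq_peval: "ev p A = peval (cf p) A"
proof -
  have "ev p A = (\<Sum>i\<le>degree p. \<Sum>j\<le>degree (coeff p i). cf p (i, j) * fst A ^ i * snd A ^ j)"
    unfolding ev_def poly_altdef[of p]
    by (simp add: poly_sum poly_altdef[of "coeff p _"] sum_distrib_left sum_distrib_right cf_def poly_const_pow
        ac_simps)
  also have "\<dots> = (\<Sum>ij\<in>(SIGMA i:{..degree p}. {..degree (coeff p i)}).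
      cf p ij * fst A ^ fst ij * snd A ^ snd ij)"
    by (subst sum.Sigma) (auto simp: case_prod_beta)
  also have "\<dots> = peval (cf p) A"
    unfolding peval_def
  proof (rule sum.mono_neutral_right)
    show "{ij. cf p ij \<noteq> 0} \<subseteq> (SIGMA i:{..degree p}. {..degree (coeff p i)})"
      by (auto simp: cf_def intro!: le_degree)
  qed auto
  finally show ?thesis .
qed

section \<open>Linear algebra through leading monomials\<close>

lemma leads_mono: "U \<subseteq> V \<Longrightarrow> leads U \<subseteq> leads V"
  by (auto simp: leads_def)

lemma leads_Int_below: "leads (V \<inter> below N) = leads V \<inter> {..<N}"
proof -
  have "l < N" if "p \<in> below N" "cf p (prod_decode l) \<noteq> 0" for p l
    using that unfolding below_def by clarify (metis not_le prod_decode_inverse surj_pair)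
  moreover have "p \<in> below N" if "p \<in> below (Suc l)" "l < N" for p l
    using below_mono[of "Suc l" N] that by auto
  ultimately show ?thesis
    by (fastforce simp: leads_def)
qed

lemma finite_leads: "V \<subseteq> below N \<Longrightarrow> finite (leads V)"
  using leads_Int_below[of V N] by (metis finite_Int finite_lessThan inf.absorb_iff1)

text \<open>Gaussian elimination: subtracting from an element of \<open>V\<close> a multiple of an
  element of \<open>U\<close> with the same leading monomial lowers its leading monomial, until
  nothing is left.\<close>

lemma subset_of_leads_subset:
  assumes V: "bp.subspace V" and U: "bp.subspace U" "U \<subseteq> V" and le: "leads V \<inter> {..<N} \<subseteq> leads U"
  shows "V \<inter> below N \<subseteq> U"
  using le
proof (induction N)
  case 0
  then show ?case using bp.subspace_0[OF U(1)] by (auto simp: below_0)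
next
  case (Suc N)
  have IH: "V \<inter> below N \<subseteq> U"
    using Suc by (auto simp: lessThan_Suc)
  show ?case
  proof
    fix v assume v: "v \<in> V \<inter> below (Suc N)"
    show "v \<in> U"
    proof (cases "cf v (prod_decode N) = 0")
      case True
      then show ?thesis using IH below_SucD v by auto
    next
      case False
      then have "N \<in> leads V" using v by (auto simp: leads_def)
      then obtain u where u: "u \<in> U" "u \<in> below (Suc N)" "cf u (prod_decode N) \<noteq> 0"
        using Suc.prems by (auto simp: leads_def)
      define w where "w = v - scal (cf v (prod_decode N) / cf u (prod_decode N)) u"
      have "w \<in> below (Suc N)"
        unfolding w_def using u v
        by (intro bp.subspace_diff bp.subspace_scale subspace_below) auto
      moreover have "cf w (prod_decode N) = 0" using u by (simp add: w_def)
      moreover have "w \<in> V"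
        unfolding w_def using u v U by (intro bp.subspace_diff bp.subspace_scale V) auto
      ultimately have "w \<in> U" using IH below_SucD by auto
      then have "w + scal (cf v (prod_decode N) / cf u (prod_decode N)) u \<in> U"
        using u U by (intro bp.subspace_add bp.subspace_scale)
      then show ?thesis by (simp add: w_def)
    qed
  qed
qed

text \<open>The number of leading monomials acts as the dimension: a pivot with leading index
  \<open>N\<close> clears this coefficient from the others and uses up one leading monomial. Taking
  a family instead of a set lets a repeated vector count as a relation.\<close>

lemma linear_relation_of_card_leads_less:
  fixes v :: "'j \<Rightarrow> real poly poly"
  assumes V: "bp.subspace V" and J: "finite J" "\<And>j. j \<in> J \<Longrightarrow> v j \<in> V \<inter> below N"
    and card: "card (leads V \<inter> {..<N}) < card J"
  obtains u where "\<exists>j\<in>J. u j \<noteq> 0" "(\<Sum>j\<in>J. scal (u j) (v j)) = 0"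
proof -
  have "\<exists>u. (\<exists>j\<in>J. u j \<noteq> 0) \<and> (\<Sum>j\<in>J. scal (u j) (v j)) = 0"
    using J card
  proof (induction N arbitrary: J v)
    case 0
    then obtain j where "j \<in> J" by fastforce
    moreover have "(\<Sum>j\<in>J. scal 1 (v j)) = 0"
      using 0 by (intro sum.neutral) (auto simp: below_0)
    ultimately show ?case by (intro exI[of _ "\<lambda>_. 1"]) auto
  next
    case (Suc N)
    show ?case
    proof (cases "\<forall>j\<in>J. cf (v j) (prod_decode N) = 0")
      case True
      then have "v j \<in> V \<inter> below N" if "j \<in> J" for j
        using Suc.prems that below_SucD by auto
      moreover have "card (leads V \<inter> {..<N}) < card J"
        using Suc.prems(3) by (rule le_less_trans[rotated]) (auto intro!: card_mono)
      ultimately show ?thesis using Suc.IH Suc.prems(1) by blast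
    next
      case False
      then obtain a where a: "a \<in> J" "cf (v a) (prod_decode N) \<noteq> 0" by auto
      define r where "r j = cf (v j) (prod_decode N) / cf (v a) (prod_decode N)" for j
      define w where "w j = v j - scal (r j) (v a)" for j
      have "N \<in> leads V" using a Suc.prems(2) by (auto simp: leads_def)
      then have "leads V \<inter> {..<Suc N} = insert N (leads V \<inter> {..<N})" by auto
      then have "card (leads V \<inter> {..<Suc N}) = Suc (card (leads V \<inter> {..<N}))" by simp
      then have "card (leads V \<inter> {..<N}) < card (J - {a})"
        using Suc.prems(1,3) a by simp
      moreover have "w j \<in> V \<inter> below N" if "j \<in> J - {a}" for j
      proof
        show "w j \<in> V" unfolding w_def
          using Suc.prems(2) that a by (intro bp.subspace_diff bp.subspace_scale V) auto
        have "w j \<in> below (Suc N)" unfolding w_def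
          using Suc.prems(2) that a by (intro bp.subspace_diff bp.subspace_scale subspace_below) auto
        moreover have "cf (w j) (prod_decode N) = 0" using a by (simp add: w_def r_def)
        ultimately show "w j \<in> below N" by (rule below_SucD)
      qed
      ultimately obtain u where u: "\<exists>j\<in>J - {a}. u j \<noteq> 0" "(\<Sum>j\<in>J - {a}. scal (u j) (w j)) = 0"
        using Suc.IH[of "J - {a}" w] Suc.prems(1) by auto
      \<comment> \<open>The coefficient of the pivot compensates for all the multiples of
        \<open>v a\<close> subtracted in the \<open>w j\<close>.\<close>
      define u' where "u' = u(a := - (\<Sum>j\<in>J - {a}. u j * r j))"
      have "(\<Sum>j\<in>J. scal (u' j) (v j)) = scal (u' a) (v a) + (\<Sum>j\<in>J - {a}. scal (u j) (v j))"
        using Suc.prems(1) a by (subst sum.remove[of _ a]) (auto simp: u'_def)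
      also have "(\<Sum>j\<in>J - {a}. scal (u j) (v j))
          = (\<Sum>j\<in>J - {a}. scal (u j) (w j)) + scal (\<Sum>j\<in>J - {a}. u j * r j) (v a)"
        by (simp add: w_def bp.scale_right_diff_distrib sum_subtractf bp.scale_sum_left)
      finally have "(\<Sum>j\<in>J. scal (u' j) (v j)) = 0"
        using u by (simp add: u'_def)
      moreover have "\<exists>j\<in>J. u' j \<noteq> 0" using u(1) by (auto simp: u'_def)
      ultimately show ?thesis by blast
    qed
  qed
  then show thesis using that by blast
qed

text \<open>Look at the monomial of the largest index with nonzero coefficient: polynomials of
  smaller index do not contain it.\<close>

lemma independent_of_distinct_leads:
  assumes fin: "finite L"
    and b: "\<And>l. l \<in> L \<Longrightarrow> b l \<in> below (Suc l) \<and> cf (b l) (prod_decode l) \<noteq> 0"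
    and sum0: "\<And>ij. (\<Sum>l\<in>L. u l * cf (b l) ij) = 0"
  shows "\<forall>l\<in>L. u l = 0" (is ?thesis)
proof (rule ccontr)
  assume *: "\<not> ?thesis"
  define M where "M = {l \<in> L. u l \<noteq> 0}"
  have M: "finite M" "M \<noteq> {}" using * fin by (auto simp: M_def)
  define m where "m = Max M"
  have m: "m \<in> M" using M by (simp add: m_def)
  have "(\<Sum>l\<in>L. u l * cf (b l) (prod_decode m)) = u m * cf (b m) (prod_decode m)"
  proof (rule sum.remove[THEN trans, OF fin])
    show "m \<in> L" using m by (simp add: M_def)
    have "u l * cf (b l) (prod_decode m) = 0" if "l \<in> L - {m}" for l
    proof (cases "u l = 0")
      case False
      then have "l \<in> M" using that by (simp add: M_def)
      then have "l \<le> m" using M by (simp add: m_def)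
      then have "l < m" using that by auto
      then show ?thesis using b[of l] that belowD[of "b l" "Suc l" "prod_decode m"] by auto
    qed auto
    then show "u m * cf (b m) (prod_decode m) + (\<Sum>l\<in>L - {m}. u l * cf (b l) (prod_decode m))
        = u m * cf (b m) (prod_decode m)" by (simp add: sum.neutral)
  qed
  then show False using sum0[of "prod_decode m"] m b[of m] by (auto simp: M_def)
qed

section \<open>Leading monomials of products\<close>

definition lead :: "real poly poly \<Rightarrow> nat \<times> nat \<Rightarrow> bool" where
  "lead p ij \<longleftrightarrow> cf p ij \<noteq> 0 \<and> p \<in> below (Suc (prod_encode ij))"

lemma leads_iff: "prod_encode ij \<in> leads V \<longleftrightarrow> (\<exists>p\<in>V. lead p ij)"
  by (auto simp: leads_def lead_def)

lemma ex_lead: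
  assumes "p \<noteq> 0"
  obtains i j where "lead p (i, j)"
proof -
  define N where "N = (LEAST N. p \<in> below N)"
  obtain m where "p \<in> below (triangle (Suc m))" by (rule ex_below)
  then have N: "p \<in> below N" unfolding N_def by (rule LeastI)
  then obtain l where l: "N = Suc l"
    using assms by (cases N) (auto simp: below_0)
  have "p \<notin> below l"
    using l not_less_Least[of l "\<lambda>N. p \<in> below N"] by (simp add: N_def)
  then have "cf p (prod_decode l) \<noteq> 0" using N l below_SucD by blast
  then have "lead p (prod_decode l)" using N l by (simp add: lead_def)
  then show thesis using that[of "fst (prod_decode l)" "snd (prod_decode l)"] by simp
qed

lemma lead_nonzero: "lead p ij \<Longrightarrow> p \<noteq> 0"
  by (auto simp: lead_def)

lemma lead_unique:
  assumes "lead p ij" "lead p ij'"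
  shows "ij = ij'"
proof -
  have "prod_encode ij' \<le> prod_encode ij" if "lead p ij" "cf p ij' \<noteq> 0" for ij ij'
  proof (rule ccontr)
    assume "\<not> prod_encode ij' \<le> prod_encode ij"
    then show False using that belowD[of p "Suc (prod_encode ij)" ij'] by (simp add: lead_def)
  qed
  then have "prod_encode ij = prod_encode ij'"
    using assms by (intro antisym) (auto simp: lead_def)
  then show ?thesis by simp
qed

lemma lead_below_triangle_iff:
  assumes "lead p (i, j)"
  shows "p \<in> below (triangle (Suc m)) \<longleftrightarrow> i + j \<le> m"
proof
  assume "p \<in> below (triangle (Suc m))"
  then have "prod_encode (i, j) < triangle (Suc m)"
    using assms by (auto simp: lead_def below_def not_less[symmetric])
  then show "i + j \<le> m" by (simp add: prod_encode_less_triangle_iff)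
next
  assume "i + j \<le> m"
  then have "Suc (prod_encode (i, j)) \<le> triangle (Suc m)"
    by (simp add: prod_encode_less_triangle_iff Suc_le_eq)
  then show "p \<in> below (triangle (Suc m))"
    using assms below_mono by (auto simp: lead_def)
qed

lemma cf_mult: "cf (p * q) (a, b) = (\<Sum>i\<le>a. \<Sum>j\<le>b. cf p (i, j) * cf q (a - i, b - j))"
  by (simp add: cf_def coeff_mult coeff_sum)

text \<open>The order is compatible with adding exponents: any other pair of monomials whose product
  is not below the claimed lead has a member beyond the lead of its factor. The fact
  \<open>zero\<close> thus serves both the leading coefficient and the vanishing of the later
  ones.\<close>

lemma lead_mult:
  assumes "lead p (i, j)" "lead q (i', j')"
  shows "lead (p * q) (i + i', j + j')"
proof -
  have zero: "cf p (s, t) * cf q (a - s, b - t) = 0"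
    if "s \<le> a" "t \<le> b" "prod_encode (i + i', j + j') \<le> prod_encode (a, b)"
      and "(s, t, a, b) \<noteq> (i, j, i + i', j + j')" for s t a b
  proof -
    have "prod_encode (i, j) < prod_encode (s, t) \<or> prod_encode (i', j') < prod_encode (a - s, b - t)"
    proof -
      have "\<not> prod_encode (a, b) < prod_encode (i + i', j + j')" using that by simp
      then show ?thesis
        using that unfolding prod_encode_less_iff by auto
    qed
    then show ?thesis using assms by (auto simp: lead_def below_def Suc_le_eq)
  qed
  have "cf (p * q) (i + i', j + j')
      = (\<Sum>(s, t)\<in>{..i + i'} \<times> {..j + j'}. cf p (s, t) * cf q (i + i' - s, j + j' - t))"
    by (simp add: cf_mult sum.cartesian_product)
  also have "\<dots> = (\<Sum>(s, t)\<in>{(i, j)}. cf p (s, t) * cf q (i + i' - s, j + j' - t))"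
  proof (rule sum.mono_neutral_right)
    show "\<forall>x\<in>{..i + i'} \<times> {..j + j'} - {(i, j)}.
        (case x of (s, t) \<Rightarrow> cf p (s, t) * cf q (i + i' - s, j + j' - t)) = 0"
      using zero[of _ "i + i'" _ "j + j'"] by fastforce
  qed auto
  finally have "cf (p * q) (i + i', j + j') \<noteq> 0" using assms by (simp add: lead_def)
  moreover have "cf (p * q) (a, b) = 0"
    if "prod_encode (i + i', j + j') < prod_encode (a, b)" for a b
    unfolding cf_mult using zero[of _ a _ b] that by (intro sum.neutral ballI) auto
  ultimately show ?thesis by (auto simp: lead_def below_def Suc_le_eq)
qed

lemma mult_below_triangle:
  assumes "p \<in> below (triangle (Suc a))" "q \<in> below (triangle (Suc b))"
  shows "p * q \<in> below (triangle (Suc (a + b)))"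
proof (cases "p = 0 \<or> q = 0")
  case True
  then show ?thesis using bp.subspace_0[OF subspace_below] by auto
next
  case False
  then obtain i j i' j' where l: "lead p (i, j)" "lead q (i', j')" by (metis ex_lead)
  then have "i + j \<le> a" "i' + j' \<le> b" using assms lead_below_triangle_iff by auto
  then show ?thesis using lead_below_triangle_iff[OF lead_mult[OF l]] by auto
qed

lemma cofactor_below_triangle:
  assumes "lead p (i, j)" "p * q \<in> below (triangle (Suc (i + j + m)))"
  shows "q \<in> below (triangle (Suc m))"
proof (cases "q = 0")
  case True
  then show ?thesis using bp.subspace_0[OF subspace_below] by auto
next
  case False
  then obtain i' j' where l: "lead q (i', j')" by (metis ex_lead)
  then show ?thesis
    using lead_below_triangle_iff[OF lead_mult[OF assms(1) l]] lead_below_triangle_iff[OF l] assms(2)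
    by auto
qed

abbreviation varx :: "real poly poly" where "varx \<equiv> [:0, 1:]"
abbreviation vary :: "real poly poly" where "vary \<equiv> [:[:0, 1:]:]"

lemma cf_monom: "cf (monom (monom r j) i) ij = (if ij = (i, j) then r else 0)"
  by (cases ij) (auto simp: cf_def)

lemma lead_monom: "r \<noteq> 0 \<Longrightarrow> lead (monom (monom r j) i) (i, j)"
  by (auto simp: lead_def below_def cf_monom)

lemma varx_eq_monom: "varx = monom (monom 1 0) 1"
  and vary_eq_monom: "vary = monom (monom 1 1) 0"
  by (simp_all add: monom_Suc monom_0 one_pCons)

lemma lead_varx: "lead varx (1, 0)" and lead_vary: "lead vary (0, 1)"
  unfolding varx_eq_monom vary_eq_monom by (simp_all only: lead_monom one_neq_zero not_False_eq_True)

lemma leads_below: "leads (below N) = {..<N}"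
proof -
  have "l \<in> leads UNIV" for l
    using lead_monom[of 1 "snd (prod_decode l)" "fst (prod_decode l)"] leads_iff[of "prod_decode l" UNIV]
    by auto
  then show ?thesis using leads_Int_below[of UNIV N] by auto
qed

text \<open>Multiplying by \<open>q\<close> translates every leading monomial by the lead of
  \<open>q\<close>, and the translation \<open>sh\<close> is injective.\<close>

lemma card_leads_mult:
  assumes "q \<noteq> 0"
  shows "card (leads ((*) q ` U)) = card (leads U)"
proof -
  obtain i j where q: "lead q (i, j)" using assms by (metis ex_lead)
  define sh where "sh l = prod_encode (i + fst (prod_decode l), j + snd (prod_decode l))" for l
  have sh: "lead (q * u) (i + fst ab, j + snd ab)" if "lead u ab" for u ab
    using lead_mult[OF q, of u "fst ab" "snd ab"] that by simp
  have "leads ((*) q ` U) = sh ` leads U"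
  proof (intro equalityI subsetI)
    fix l assume "l \<in> leads ((*) q ` U)"
    then obtain u where u: "u \<in> U" "lead (q * u) (prod_decode l)"
      using leads_iff[of "prod_decode l"] by auto
    then have "u \<noteq> 0" using lead_nonzero by fastforce
    then obtain a b where ab: "lead u (a, b)" by (metis ex_lead)
    have "prod_decode l = (i + a, j + b)" using lead_unique[OF u(2) sh[OF ab]] by simp
    then have "l = prod_encode (i + a, j + b)" using prod_decode_inverse[of l] by simp
    then have "l = sh (prod_encode (a, b))" by (simp add: sh_def)
    moreover have "prod_encode (a, b) \<in> leads U" using ab u(1) leads_iff by blast
    ultimately show "l \<in> sh ` leads U" by (rule image_eqI)
  next
    fix l assume "l \<in> sh ` leads U"
    then obtain l' where l': "l = sh l'" "l' \<in> leads U" by (rule imageE)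
    then obtain u where u: "u \<in> U" "lead u (prod_decode l')"
      using leads_iff[of "prod_decode l'" U] by auto
    show "l \<in> leads ((*) q ` U)"
      unfolding l' sh_def leads_iff using sh[OF u(2)] u(1) by blast
  qed
  moreover have "inj sh"
  proof (rule injI)
    fix l l' assume "sh l = sh l'"
    then have "prod_decode l = prod_decode l'" by (intro prod_eqI) (auto simp: sh_def)
    then show "l = l'" by simp
  qed
  ultimately show ?thesis by (simp add: card_image inj_on_subset)
qed

lemma subspace_mult:
  assumes "bp.subspace U" shows "bp.subspace ((*) q ` U)"
proof -
  have "q * u + q * v \<in> (*) q ` U" if "u \<in> U" "v \<in> U" for u v
    using bp.subspace_add[OF assms that] by (metis distrib_left image_eqI)
  moreover have "scal r (q * u) \<in> (*) q ` U" if "u \<in> U" for u r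
    using bp.subspace_scale[OF assms that] by (metis scal_mult_right image_eqI)
  ultimately show ?thesis
    using bp.subspace_0[OF assms] by (auto simp: bp.subspace_def image_iff)
qed

lemma subspace_eq_of_card_leads_le:
  assumes "bp.subspace V" "bp.subspace U" "U \<subseteq> V" "V \<subseteq> below N" "card (leads V) \<le> card (leads U)"
  shows "U = V"
proof -
  have "leads U = leads V"
    using assms leads_mono finite_leads by (intro card_seteq) auto
  then show ?thesis using subset_of_leads_subset[of V U N] assms by auto
qed

text \<open>The products of \<open>f\<close> with the first \<open>M\<close> monomials and of
  \<open>g\<close> with the first \<open>M'\<close> monomials are more elements than the dimension
  allows, hence linearly dependent.\<close>

lemma ex_syzygy:
  assumes V: "bp.subspace V"
    and f: "\<And>c. c \<in> below M \<Longrightarrow> f * c \<in> V \<inter> below N"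
    and g: "\<And>c. c \<in> below M' \<Longrightarrow> g * c \<in> V \<inter> below N"
    and less: "card (leads V \<inter> {..<N}) < M + M'"
  obtains c d where "c \<in> below M" "d \<in> below M'" "c \<noteq> 0 \<or> d \<noteq> 0" "f * c + g * d = 0"
proof -
  define mon :: "nat \<Rightarrow> real poly poly" where
    "mon l = monom (monom 1 (snd (prod_decode l))) (fst (prod_decode l))" for l
  have cf_mon: "cf (mon l) ij = (if ij = prod_decode l then 1 else 0)" for l ij
    by (simp add: mon_def cf_monom)
  have mon: "mon l \<in> below M" if "l < M" for l M
    using that by (auto simp: below_def cf_mon)
  \<comment> \<open>The disjoint sum of index sets counts a product of \<open>f\<close> and an equal
    product of \<open>g\<close> separately.\<close>
  define v where "v = case_sum (\<lambda>l. f * mon l) (\<lambda>l. g * mon l)"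
  have "v s \<in> V \<inter> below N" if "s \<in> {..<M} <+> {..<M'}" for s
    using that f[OF mon] g[OF mon] by (auto simp: v_def)
  moreover have "card ({..<M} <+> {..<M'}) = M + M'" by (simp add: card_Plus)
  ultimately obtain u where u: "\<exists>s\<in>{..<M} <+> {..<M'}. u s \<noteq> 0"
      "(\<Sum>s\<in>{..<M} <+> {..<M'}. scal (u s) (v s)) = 0"
    using linear_relation_of_card_leads_less[OF V, of "{..<M} <+> {..<M'}" v N] less by auto
  define c d where "c = (\<Sum>l<M. scal (u (Inl l)) (mon l))" and "d = (\<Sum>l<M'. scal (u (Inr l)) (mon l))"
  have cf_c: "cf c (prod_decode l) = u (Inl l)" if "l < M" for l
    using that by (simp add: c_def cf_mon if_distrib[of "\<lambda>x. _ * x"] cong: if_cong)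
  have cf_d: "cf d (prod_decode l) = u (Inr l)" if "l < M'" for l
    using that by (simp add: d_def cf_mon if_distrib[of "\<lambda>x. _ * x"] cong: if_cong)
  show thesis
  proof
    show "c \<in> below M" "d \<in> below M'"
      unfolding c_def d_def using mon
      by (auto intro!: bp.subspace_sum bp.subspace_scale subspace_below)
    show "c \<noteq> 0 \<or> d \<noteq> 0" using u(1) cf_c cf_d by auto
    show "f * c + g * d = 0"
      using u(2) by (simp add: sum.Plus v_def c_def d_def sum_distrib_left)
  qed
qed

section \<open>Linear relations between curves\<close>

text \<open>The vector of the three elements is orthogonal to both coefficient vectors, so it is
  proportional to their cross product; the cross-multiplied form avoids division.\<close>

lemma linear_relations_cross_product:
  fixes p\<^sub>0 p\<^sub>1 p\<^sub>2 :: "'a :: comm_ring_1"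
  assumes "a * p\<^sub>2 + b * p\<^sub>1 + c * p\<^sub>0 = 0" "a' * p\<^sub>2 + b' * p\<^sub>1 + c' * p\<^sub>0 = 0"
  shows "(a * b' - b * a') * p\<^sub>2 = (b * c' - c * b') * p\<^sub>0"
    and "(a * b' - b * a') * p\<^sub>1 = (c * a' - a * c') * p\<^sub>0"
proof -
  have "(a * b' - b * a') * p\<^sub>2 - (b * c' - c * b') * p\<^sub>0
      = b' * (a * p\<^sub>2 + b * p\<^sub>1 + c * p\<^sub>0) - b * (a' * p\<^sub>2 + b' * p\<^sub>1 + c' * p\<^sub>0)"
    by (simp add: algebra_simps)
  then show "(a * b' - b * a') * p\<^sub>2 = (b * c' - c * b') * p\<^sub>0"
    using assms by simp
  have "(a * b' - b * a') * p\<^sub>1 - (c * a' - a * c') * p\<^sub>0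
      = a * (a' * p\<^sub>2 + b' * p\<^sub>1 + c' * p\<^sub>0) - a' * (a * p\<^sub>2 + b * p\<^sub>1 + c * p\<^sub>0)"
    by (simp add: algebra_simps)
  then show "(a * b' - b * a') * p\<^sub>1 = (c * a' - a * c') * p\<^sub>0"
    using assms by simp
qed

text \<open>The two conics have no common component: their leading forms are $y^2$ (up to a scalar) and $x^2$.\<close>

lemma common_cofactor_of_conics:
  fixes w u s c :: "real poly" and p p' :: "real poly poly"
  assumes deg: "degree w \<le> 1" "degree u = 0" "degree c = 0" "degree s = 2"
    and eq: "[:s, c:] * p = [:w, u, 1:] * p'"
  obtains q where "p = [:w, u, 1:] * q" "p' = [:s, c:] * q"
proof -
  let ?M = "[:w, u, 1:]" and ?N = "[:s, c:]"
  have s: "s \<noteq> 0" using deg by auto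
  \<comment> \<open>\<open>?M\<close> is monic in x, so pseudo-division is ordinary division and
    leaves a remainder of degree at most 1 in x.\<close>
  obtain q r where qr: "pseudo_divmod p ?M = (q, r)" by fastforce
  have p: "p = ?M * q + r" and r: "r = 0 \<or> degree r < 2"
    using pseudo_divmod[OF _ qr] by auto
  define d where "d = p' - ?N * q"
  have Nr: "?N * r = ?M * d"
  proof -
    have "?N * r = ?N * p - ?M * (?N * q)"
      unfolding p distrib_left by (simp only: mult.left_commute[of ?N ?M] add_diff_cancel_left')
    then show ?thesis unfolding eq d_def right_diff_distrib .
  qed
  have "r = 0"
  proof (rule ccontr)
    assume "r \<noteq> 0"
    have "?N * r \<noteq> 0" using s \<open>r \<noteq> 0\<close> by (intro no_zero_divisors) auto
    then have "d \<noteq> 0" using Nr by auto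
    have r01: "r = [:coeff r 0, coeff r 1:]"
      using r \<open>r \<noteq> 0\<close> by (intro poly_eqI) (auto simp: coeff_pCons coeff_eq_0 split: nat.split)
    define r0 r1 where "r0 = coeff r 0" and "r1 = coeff r 1"
    have r01: "r = [:r0, r1:]" using r01 by (simp add: r0_def r1_def)
    have "degree (?M * d) = 2 + degree d"
      using \<open>d \<noteq> 0\<close> by (subst degree_mult_eq) auto
    moreover have "degree (?N * r) \<le> 2"
    proof -
      have "degree ?N \<le> 1" by simp
      moreover have "degree r \<le> 1" using r \<open>r \<noteq> 0\<close> by auto
      ultimately show ?thesis using degree_mult_le[of ?N r] by linarith
    qed
    ultimately have "degree d = 0" using Nr by simp
    then obtain e where d: "d = [:e:]" by (rule degree_eq_zeroE)
    have e: "s * r0 = w * e" "s * r1 + c * r0 = u * e" "c * r1 = e"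
      using Nr unfolding r01 d by (auto simp: ac_simps)
    have e1: "s * r0 = w * c * r1" and e2: "s * r1 = c * (u * r1 - r0)"
      using e by (auto simp: algebra_simps)
    show False
    proof (cases "r1 = 0")
      case True
      then show False using e1 s r01 \<open>r \<noteq> 0\<close> by auto
    next
      case False
      \<comment> \<open>Compare degrees in y: by \<open>e2\<close> the degree of \<open>r0\<close>
        exceeds that of \<open>r1\<close> by at least 2, which makes the degree of
        \<open>s * r0\<close> too large for \<open>e1\<close>.\<close>
      then have d1: "degree (s * r1) = 2 + degree r1" using s deg by (simp add: degree_mult_eq)
      have "degree (c * (u * r1 - r0)) \<le> degree (u * r1 - r0)"
        using degree_mult_le[of c "u * r1 - r0"] deg by simp
      also have "\<dots> \<le> max (degree r1) (degree r0)"
        using degree_diff_le_max[of "u * r1" r0] degree_mult_le[of u r1] deg by linarith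
      finally have "2 + degree r1 \<le> degree r0" using d1 e2 by simp
      moreover from this have "degree (s * r0) = 2 + degree r0" using s deg
        by (subst degree_mult_eq) auto
      moreover have "degree (w * c * r1) \<le> 1 + degree r1"
        using degree_mult_le[of "w * c" r1] degree_mult_le[of w c] deg by linarith
      ultimately show False using e1 by simp
    qed
  qed
  then have "p = ?M * q" using p by simp
  moreover have "?M * d = 0" using Nr \<open>r = 0\<close> by simp
  then have "d = 0" unfolding mult_eq_0_iff by simp
  then have "p' = ?N * q" by (simp add: d_def)
  ultimately show thesis by (rule that)
qed

section \<open>Polynomials of degree at most one\<close>

lemma below_triangle_1E:
  assumes "p \<in> below (triangle (Suc 0))"
  obtains r where "p = [:[:r:]:]"
proof
  have "cf p (i, j) = 0" if "0 < i + j" for i j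
    using assms that by (auto simp: below_triangle_iff Pi_deg_def)
  then show "p = [:[:cf p (0, 0):]:]"
    unfolding poly_eq_iff by (auto simp: coeff_pCons cf_def split: nat.split)
qed

lemma below_triangle_2E:
  assumes "p \<in> below (triangle (Suc 1))"
  obtains r s t where "p = [:[:r, s:], [:t:]:]"
proof
  have "cf p (i, j) = 0" if "1 < i + j" for i j
    using assms that unfolding below_triangle_iff Pi_deg_def
    by (metis (mono_tags, lifting) mem_Collect_eq not_le)
  then show "p = [:[:cf p (0, 0), cf p (0, 1):], [:cf p (1, 0):]:]"
    unfolding poly_eq_iff by (auto simp: coeff_pCons cf_def split: nat.split)
qed

text \<open>Up to the unit \<open>[:b:]\<close> this is \<open>[:- c, 1:]\<close>, and divisibility
  by that means a root at \<open>c\<close>; a product vanishing at \<open>c\<close> has a factor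
  vanishing there.\<close>

lemma prime_elem_linear_poly:
  fixes a b :: "'a :: idom_divide"
  assumes b': "b * b' = 1"
  shows "prime_elem [:a, b:]"
proof -
  define c where "c = - (a * b')"
  have "\<not> is_unit [:- c, 1:]" by (auto simp: is_unit_poly_iff)
  moreover have "[:- c, 1:] dvd p \<or> [:- c, 1:] dvd q" if "[:- c, 1:] dvd p * q" for p q
    using that by (simp add: poly_eq_0_iff_dvd[symmetric])
  ultimately have "prime_elem [:- c, 1:]" by (intro prime_elemI) auto
  moreover have "b * c = - a" using b' by (simp add: c_def mult.left_commute[of b a])
  then have "[:a, b:] = [:b:] * [:- c, 1:]" by (simp add: mult.commute[of c])
  moreover have "[:b:] * [:b':] = 1" using b' by (simp add: one_pCons mult.commute[of b'])
  then have "is_unit [:b:]" by (metis dvdI)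
  ultimately show ?thesis by (simp only: prime_elem_mult_unit_left)
qed

text \<open>The coefficient of x, if nonzero, is a real constant and so a unit; otherwise the line
  is a linear polynomial in y, and primality lifts from \<open>real poly\<close>.\<close>

lemma prime_elem_line:
  assumes "l \<in> below (triangle (Suc 1))" "l \<notin> below (triangle (Suc 0))"
  shows "prime_elem l"
proof -
  obtain r s t where l: "l = [:[:r, s:], [:t:]:]" using assms(1) by (rule below_triangle_2E)
  show ?thesis
  proof (cases "t = 0")
    case False
    then show ?thesis
      unfolding l by (intro prime_elem_linear_poly[where b' = "[:1 / t:]"]) (simp add: one_pCons)
  next
    case True
    have "s \<noteq> 0"
    proof
      assume "s = 0"
      then have "cf l \<in> Pi_deg 0" using True l
        by (auto simp: Pi_deg_def cf_def coeff_pCons split: nat.splits)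
      then show False using assms(2) by (simp add: below_triangle_iff)
    qed
    then have "prime_elem [:r, s:]"
      by (intro prime_elem_linear_poly[where b' = "1 / s"]) simp
    then show ?thesis using True l by (simp add: lift_prime_elem_poly)
  qed
qed

section \<open>Growth of the number of leading monomials\<close>

lemma card_Un_Suc_image_ge:
  assumes "finite F" "F \<noteq> {}" "F \<union> Suc ` F \<subseteq> G" "finite G"
  shows "Suc (card F) \<le> card G"
proof -
  have "Suc (Max F) \<notin> F" using assms(1) Max_ge not_less_eq_eq by blast
  moreover have "Suc (Max F) \<in> G" using assms Max_in by auto
  ultimately have "card (insert (Suc (Max F)) F) = Suc (card F)" "insert (Suc (Max F)) F \<subseteq> G"
    using assms by auto
  then show ?thesis using card_mono assms(4) by metis
qed

text \<open>Besides the successor of the maximum, a gap in \<open>F\<close> would contribute a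
  second new element to \<open>G\<close>.\<close>

lemma interval_of_card_Un_Suc_image:
  assumes "finite F" "F \<noteq> {}" "F \<union> Suc ` F \<subseteq> G" "finite G" "card G = Suc (card F)"
  obtains a where "F = {a..<a + card F}" "G = {a..a + card F}"
proof -
  define a b where "a = Min F" and "b = Max F"
  have ab: "a \<in> F" "b \<in> F" "F \<subseteq> {a..b}"
    using assms by (auto simp: a_def b_def)
  have step: "Suc i \<in> F" if "i \<in> F" "i < b" for i
  proof (rule ccontr)
    assume n: "Suc i \<notin> F"
    have "Suc b \<notin> F" using ab(3) by auto
    then have "card (insert (Suc i) (insert (Suc b) F)) = Suc (Suc (card F))"
      using n that assms(1) by simp
    moreover have "insert (Suc i) (insert (Suc b) F) \<subseteq> G" using assms(3) ab that by auto
    ultimately have "Suc (Suc (card F)) \<le> Suc (card F)"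
      using card_mono[OF assms(4)] assms(5) by metis
    then show False by simp
  qed
  have "a + d \<in> F" if "a + d \<le> b" for d
    using that by (induction d) (simp_all add: ab(1) step)
  then have "i \<in> F" if "a \<le> i" "i \<le> b" for i using that le_add_diff_inverse[of a i] by metis
  then have "{a..b} \<subseteq> F" by (intro subsetI) simp
  then have F: "F = {a..b}" using ab(3) by (rule equalityI[rotated])
  have "a \<le> b" using ab by auto
  have "insert (Suc b) F \<subseteq> G" using assms(3) ab by auto
  moreover have "card (insert (Suc b) F) = card G" using assms(5) F by simp
  ultimately have "G = insert (Suc b) F" using assms(4) by (metis card_subset_eq)
  then show thesis using F \<open>a \<le> b\<close> by (intro that[of a]) auto
qed

text \<open>Read backwards from \<open>k\<close>, the values drop strictly until they reach 0, so
  they are bounded by \<open>e k\<close>, \<open>e k - 1\<close>, and so on.\<close>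

lemma sum_le_triangle:
  fixes e :: "nat \<Rightarrow> nat"
  assumes "\<And>m. 0 < e m \<Longrightarrow> e m < e (Suc m)"
  shows "(\<Sum>m\<le>k. e m) \<le> triangle (e k)"
proof -
  have tri: "triangle a + b \<le> triangle b" if ab: "a < b" for a b
  proof -
    obtain c where c: "b = Suc c" "a \<le> c" using less_imp_Suc_add[OF ab] le_add1 by blast
    have "mono triangle" by (rule mono_iff_le_Suc [THEN iffD2]) (simp add: triangle_Suc)
    then show ?thesis using c monoD[of triangle a c] by (simp add: triangle_Suc)
  qed
  show ?thesis
  proof (induction k)
    case 0
    then show ?case using tri[of 0 "e 0"] by (cases "e 0") auto
  next
    case (Suc k)
    show ?case
    proof (cases "e k = 0")
      case True
      then show ?thesis using Suc tri[of 0 "e (Suc k)"] by (cases "e (Suc k)") auto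
    next
      case False
      then show ?thesis using Suc assms[of k] tri[of "e k" "e (Suc k)"] by simp
    qed
  qed
qed

text \<open>Once \<open>e\<close> has reached \<open>c\<close>, the next \<open>d\<close> values are
  at least \<open>c + 1\<close> up to \<open>c + d\<close>. Moving \<open>triangle c\<close> to the
  right avoids subtraction on the naturals.\<close>

lemma sum_ge_triangle:
  fixes e :: "nat \<Rightarrow> nat"
  assumes "\<And>m. 0 < e m \<Longrightarrow> e m < e (Suc m)" and "0 < c" "c \<le> e m"
  shows "(\<Sum>i\<le>m. e i) + triangle (c + d) \<le> (\<Sum>i\<le>m + d. e i) + triangle c"
proof -
  have "c + d \<le> e (m + d)" for d
  proof (induction d)
    case (Suc d)
    then show ?case using assms(1)[of "m + d"] assms(2) by simp
  qed (simp add: assms)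
  note ge = this
  show ?thesis
  proof (induction d)
    case (Suc d)
    then show ?case using ge[of "Suc d"] by (simp add: triangle_Suc)
  qed simp
qed

text \<open>Here \<open>k\<close> is the degree of the curve sought, \<open>k + 3\<close> that of
  the given polynomials, and \<open>k + 3 + Suc d\<close> the degree of independence. With a sum of
  7 up to \<open>k + 3\<close>, minimal growth afterwards already exhausts the bound
  \<open>le\<close>.\<close>

lemma growth_dichotomy:
  fixes e :: "nat \<Rightarrow> nat"
  assumes inc: "\<And>m. 0 < e m \<Longrightarrow> e m < e (Suc m)"
    and le: "(\<Sum>i\<le>k + 3 + Suc d. e i) + 3 \<le> triangle (Suc d + 4)"
    and ge: "7 \<le> (\<Sum>i\<le>k + 3. e i)"
  shows "(\<Sum>i\<le>k + 3. e i) = 7" "e (k + 4) = 5" "e (k + 3) = 4"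
    "(\<Sum>i\<le>k + 1. e i) = 0 \<and> e (k + 2) = 3
      \<or> (\<Sum>i\<le>k. e i) = 0 \<and> e (k + 1) = 1 \<and> e (k + 2) = 2"
proof -
  have tri: "triangle 0 = 0" "triangle 1 = 1" "triangle 2 = 3" "triangle 3 = 6" "triangle 4 = 10"
    "triangle 5 = 15" "triangle 6 = 21"
    by (simp_all add: triangle_def)
  have small: "triangle a \<le> 6" if "a \<le> 3" for a
  proof -
    from that consider "a = 0" | "a = 1" | "a = 2" | "a = 3" by linarith
    then show ?thesis using tri by cases auto
  qed
  \<comment> \<open>A sum of at least 7 exceeds \<open>triangle 3\<close>, so the last term is at
    least 4; the growth this forces leaves room for no more than 7 up to degree
    \<open>k + 3\<close>.\<close>
  have e3: "4 \<le> e (k + 3)"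
    using sum_le_triangle[of e "k + 3", OF inc] small[of "e (k + 3)"] ge by linarith
  have "(\<Sum>i\<le>k + 3. e i) + triangle (4 + Suc d) \<le> (\<Sum>i\<le>k + 3 + Suc d. e i) + triangle 4"
    using e3 by (intro sum_ge_triangle inc) auto
  then show s7: "(\<Sum>i\<le>k + 3. e i) = 7" using le ge tri by (simp add: add.commute)
  have e4: "e (k + 3) < e (k + 4)" using inc[of "k + 3"] e3 by (simp add: numeral_eq_Suc)
  \<comment> \<open>A value of 6 or more at \<open>k + 4\<close> would, with the growth it forces,
    exceed the bound \<open>le\<close>.\<close>
  have "e (k + 4) < 6"
  proof (rule ccontr)
    assume "\<not> e (k + 4) < 6"
    then have "(\<Sum>i\<le>k + 4. e i) + triangle (6 + d) \<le> (\<Sum>i\<le>k + 4 + d. e i) + triangle 6"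
      by (intro sum_ge_triangle inc) auto
    moreover have "(\<Sum>i\<le>k + 4. e i) = 7 + e (k + 4)"
      using s7 by (simp add: numeral_eq_Suc)
    moreover have "k + 4 + d = k + 3 + Suc d" by simp
    moreover have "triangle (6 + d) = triangle (Suc d + 4) + (6 + d)"
      using triangle_Suc[of "Suc d + 4"] by (simp add: numeral_eq_Suc)
    ultimately show False using le tri \<open>\<not> e (k + 4) < 6\<close> by simp
  qed
  then show "e (k + 4) = 5" "e (k + 3) = 4" using e3 e4 by auto
  have S: "(\<Sum>i\<le>k + 3. e i) = (\<Sum>i\<le>k + 2. e i) + e (k + 3)"
    "(\<Sum>i\<le>k + 2. e i) = (\<Sum>i\<le>k + 1. e i) + e (k + 2)"
    "(\<Sum>i\<le>k + 1. e i) = (\<Sum>i\<le>k. e i) + e (k + 1)"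
    by (simp_all add: numeral_eq_Suc)
  \<comment> \<open>The degrees up to \<open>k + 2\<close> contribute 3 in total, the last one 3 or
    2; in the latter case the remaining 1 sits at \<open>k + 1\<close>, since a zero value has only
    zeros before it.\<close>
  have s3: "(\<Sum>i\<le>k + 2. e i) = 3" using S s7 \<open>e (k + 3) = 4\<close> by simp
  have le2: "3 \<le> triangle (e (k + 2))" using sum_le_triangle[of e "k + 2", OF inc] s3 by simp
  have "e (k + 2) \<noteq> 0" "e (k + 2) \<noteq> 1" "e (k + 2) \<le> 3"
  proof -
    show "e (k + 2) \<noteq> 0" "e (k + 2) \<noteq> 1" using le2 tri(1,2) by (intro notI; simp only:; simp)+
    show "e (k + 2) \<le> 3" using S(2) s3 by linarith
  qed
  then consider "e (k + 2) = 3" | "e (k + 2) = 2" by linarith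
  then show "(\<Sum>i\<le>k + 1. e i) = 0 \<and> e (k + 2) = 3
      \<or> (\<Sum>i\<le>k. e i) = 0 \<and> e (k + 1) = 1 \<and> e (k + 2) = 2"
  proof cases
    case 1
    then show ?thesis using S s3 by simp
  next
    case 2
    have "(\<Sum>i\<le>k + 1. e i) = 1" using 2 S s3 by simp
    moreover have "e (k + 1) \<noteq> 0"
      using sum_le_triangle[of e "k + 1", OF inc] calculation tri by (intro notI) simp
    ultimately have "e (k + 1) = 1" "(\<Sum>i\<le>k. e i) = 0" using S(3) by linarith+
    then show ?thesis using 2 by blast
  qed
qed

section \<open>The vanishing ideal of a node set\<close>

definition vanish :: "(real \<times> real) set \<Rightarrow> real poly poly set" where
  "vanish X = {p. \<forall>A\<in>X. ev p A = 0}"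

text \<open>A monomial of known degree \<open>m\<close> is recorded by its exponent of $x$.\<close>

definition exps :: "(real \<times> real) set \<Rightarrow> nat \<Rightarrow> nat set" where
  "exps X m = {i. i \<le> m \<and> prod_encode (i, m - i) \<in> leads (vanish X)}"

lemma subspace_vanish: "bp.subspace (vanish X)"
  by (auto simp: bp.subspace_def vanish_def)

lemma vanish_mult: "p \<in> vanish X \<Longrightarrow> r * p \<in> vanish X" "p \<in> vanish X \<Longrightarrow> p * r \<in> vanish X"
  by (auto simp: vanish_def)

lemma subspace_vanish_below: "bp.subspace (vanish X \<inter> below N)"
  by (intro bp.subspace_inter subspace_vanish subspace_below)

lemma cf_in_vanishing_iff: "cf p \<in> vanishing m X \<longleftrightarrow> p \<in> vanish X \<inter> below (triangle (Suc m))"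
  by (auto simp: vanishing_def vanish_def below_triangle_iff ev_eq_peval)

lemma exps_iff: "i \<in> exps X m \<longleftrightarrow> i \<le> m \<and> (\<exists>p\<in>vanish X. lead p (i, m - i))"
  by (simp add: exps_def leads_iff)

lemma finite_exps [simp]: "finite (exps X m)"
  by (rule finite_subset[of _ "{..m}"]) (auto simp: exps_def)

lemma card_leads_vanish: "card (leads (vanish X) \<inter> {..<triangle m}) = (\<Sum>i<m. card (exps X i))"
proof (induction m)
  case (Suc m)
  have enc: "prod_encode (i, m - i) = triangle m + i" if "i \<le> m" for i
    using that by (simp add: prod_encode_def)
  have "leads (vanish X) \<inter> {triangle m..<triangle (Suc m)} = (+) (triangle m) ` exps X m"
  proof (intro equalityI subsetI)
    fix l assume l: "l \<in> leads (vanish X) \<inter> {triangle m..<triangle (Suc m)}"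
    then have "l - triangle m \<le> m" by (auto simp: triangle_Suc)
    then have "l - triangle m \<in> exps X m" using l enc[of "l - triangle m"] by (simp add: exps_def)
    moreover have "l = triangle m + (l - triangle m)" using l by simp
    ultimately show "l \<in> (+) (triangle m) ` exps X m" by blast
  qed (auto simp: exps_def enc triangle_Suc)
  then have "card (leads (vanish X) \<inter> {triangle m..<triangle (Suc m)}) = card (exps X m)"
    by (simp add: card_image)
  moreover have "leads (vanish X) \<inter> {..<triangle (Suc m)}
      = (leads (vanish X) \<inter> {..<triangle m}) \<union> (leads (vanish X) \<inter> {triangle m..<triangle (Suc m)})"
    by (auto simp: triangle_Suc)
  moreover have "card \<dots> = card (leads (vanish X) \<inter> {..<triangle m})
      + card (leads (vanish X) \<inter> {triangle m..<triangle (Suc m)})"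
    by (intro card_Un_disjoint) auto
  ultimately show ?case using Suc by simp
qed simp

text \<open>Multiplication by y keeps the exponent of x, and multiplication by x raises it by
  one.\<close>

lemma exps_Suc: "exps X m \<union> Suc ` exps X m \<subseteq> exps X (Suc m)"
proof -
  have "i \<in> exps X (Suc m) \<and> Suc i \<in> exps X (Suc m)" if i: "i \<in> exps X m" for i
  proof -
    obtain p where p: "p \<in> vanish X" "lead p (i, m - i)" "i \<le> m"
      using i unfolding exps_iff by blast
    have "lead (vary * p) (i, Suc m - i)" "lead (varx * p) (Suc i, m - i)"
      using lead_mult[OF lead_vary p(2)] lead_mult[OF lead_varx p(2)] p(3) by (simp_all add: Suc_diff_le)
    moreover have "vary * p \<in> vanish X" "varx * p \<in> vanish X" using vanish_mult p(1) by blast+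
    ultimately show ?thesis using p(3) unfolding exps_iff by auto
  qed
  then show ?thesis by auto
qed

lemma card_exps_less: "0 < card (exps X m) \<Longrightarrow> card (exps X m) < card (exps X (Suc m))"
  using card_Un_Suc_image_ge[OF _ _ exps_Suc[of X m]] by (auto simp: card_gt_0_iff Suc_le_eq)

lemma vanish_insert_subset: "vanish (insert A Y) \<subseteq> vanish Y"
  by (auto simp: vanish_def)

lemma n_independent_subset:
  assumes "n_independent n X" "Y \<subseteq> X"
  shows "n_independent n Y"
  using assms unfolding n_independent_def fundamental_def by blast

text \<open>The fundamental polynomial of a new node vanishes on the old nodes but not at the new
  one, so each node lowers the dimension.\<close>

lemma card_leads_vanish_le:
  assumes "finite X" "n_independent n X"
  shows "card (leads (vanish X \<inter> below (triangle (Suc n)))) + card X \<le> triangle (Suc n)"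
  using assms
proof (induction X rule: finite_induct)
  case empty
  then show ?case by (simp add: vanish_def leads_below)
next
  case (insert A Y)
  let ?B = "below (triangle (Suc n))"
  have "n_independent n Y" using insert.prems by (rule n_independent_subset) blast
  then have IH: "card (leads (vanish Y \<inter> ?B)) + card Y \<le> triangle (Suc n)" by (rule insert.IH)
  obtain c where c: "fundamental n (insert A Y) A c"
    using insert.prems unfolding n_independent_def by auto
  then obtain p where p: "cf p = c" using ex_cf_of_Pi_deg unfolding fundamental_def by blast
  have "p \<in> vanish Y \<inter> ?B" "p \<notin> vanish (insert A Y) \<inter> ?B"
    using c insert.hyps(2) unfolding fundamental_def p[symmetric]
    by (auto simp: vanish_def below_triangle_iff ev_eq_peval)
  then have "\<not> card (leads (vanish Y \<inter> ?B)) \<le> card (leads (vanish (insert A Y) \<inter> ?B))"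
    using subspace_eq_of_card_leads_le[OF subspace_vanish_below[of Y] subspace_vanish_below[of "insert A Y"],
        of "triangle (Suc n)" "triangle (Suc n)" "triangle (Suc n)"] vanish_insert_subset[of A Y] by blast
  then show ?case using IH insert.hyps by simp
qed

text \<open>A new node removes at most one leading monomial: given two lost ones, a multiple of the
  polynomial with the smaller lead corrects the other to vanish at the node without changing its
  lead.\<close>

lemma card_leads_vanish_ge:
  assumes "finite X"
  shows "N \<le> card (leads (vanish X \<inter> below N)) + card X"
  using assms
proof (induction X rule: finite_induct)
  case empty
  then show ?case by (simp add: vanish_def leads_below)
next
  case (insert A Y)
  let ?V = "vanish Y \<inter> below N" and ?U = "vanish (insert A Y) \<inter> below N"
  have fin: "finite (leads ?V)" "finite (leads ?U)" by (intro finite_leads[of _ N]; blast)+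
  have eq: "\<not> l < l'" if l: "l \<in> leads ?V - leads ?U" "l' \<in> leads ?V - leads ?U" for l l'
  proof
    assume "l < l'"
    obtain p where p: "p \<in> ?V" "p \<in> below (Suc l)" "cf p (prod_decode l) \<noteq> 0"
      using l(1) unfolding leads_def by blast
    obtain p' where p': "p' \<in> ?V" "p' \<in> below (Suc l')" "cf p' (prod_decode l') \<noteq> 0"
      using l(2) unfolding leads_def by blast
    have "ev p A \<noteq> 0"
    proof
      assume "ev p A = 0"
      then have "p \<in> ?U" using p(1) by (auto simp: vanish_def)
      then show False using l(1) p unfolding leads_def by blast
    qed
    define w where "w = p' - scal (ev p' A / ev p A) p"
    have "w \<in> ?V" unfolding w_def
      using p(1) p'(1) by (intro bp.subspace_diff bp.subspace_scale subspace_vanish_below)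
    moreover have "ev w A = 0" using \<open>ev p A \<noteq> 0\<close> by (simp add: w_def)
    ultimately have "w \<in> ?U" by (auto simp: vanish_def)
    moreover have "p \<in> below (Suc l')" using p(2) \<open>l < l'\<close> below_mono[of "Suc l" "Suc l'"] by auto
    then have "w \<in> below (Suc l')" unfolding w_def
      using p'(2) by (intro bp.subspace_diff bp.subspace_scale subspace_below)
    moreover have "cf p (prod_decode l') = 0" using belowD[OF p(2)] \<open>l < l'\<close> by simp
    then have "cf w (prod_decode l') \<noteq> 0" using p'(3) by (simp add: w_def)
    ultimately have "l' \<in> leads ?U" unfolding leads_def by blast
    then show False using l by blast
  qed
  have "card (leads ?V - leads ?U) \<le> 1"
  proof (rule ccontr)
    assume "\<not> ?thesis"
    then obtain l l' where "l \<in> leads ?V - leads ?U" "l' \<in> leads ?V - leads ?U" "l \<noteq> l'"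
      using fin card_le_Suc0_iff_eq[of "leads ?V - leads ?U"] by auto
    then show False using eq[of l l'] eq[of l' l] by linarith
  qed
  moreover have "card (leads ?V) \<le> card (leads ?U \<union> (leads ?V - leads ?U))"
    using fin by (intro card_mono) auto
  moreover have "card (leads ?U \<union> (leads ?V - leads ?U)) \<le> card (leads ?U) + card (leads ?V - leads ?U)"
    by (rule card_Un_le)
  ultimately have "card (leads ?V) \<le> card (leads ?U) + 1" by linarith
  then show ?case using insert.IH insert.hyps by simp
qed

section \<open>Dimension and linearly independent sets\<close>

lemma card_le_card_leads_of_lin_indep:
  assumes S: "finite S" "S \<subseteq> vanishing k X" "lin_indep S"
  shows "card S \<le> card (leads (vanish X \<inter> below (triangle (Suc k))))"
proof (rule ccontr)
  assume less: "\<not> ?thesis"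
  have "\<forall>c\<in>S. \<exists>p. cf p = c"
    using S(2) ex_cf_of_Pi_deg unfolding vanishing_def by blast
  then obtain v where v: "\<And>c. c \<in> S \<Longrightarrow> cf (v c) = c" by metis
  have "v c \<in> vanish X \<inter> below (triangle (Suc k))" if "c \<in> S" for c
    using v[OF that] S(2) that cf_in_vanishing_iff[of "v c" k X] by auto
  then obtain u where u: "\<exists>c\<in>S. u c \<noteq> 0" "(\<Sum>c\<in>S. scal (u c) (v c)) = 0"
    using linear_relation_of_card_leads_less[OF subspace_vanish S(1), of v X "triangle (Suc k)"]
      less leads_Int_below[of "vanish X" "triangle (Suc k)"] by (metis linorder_not_le)
  have "(\<Sum>c\<in>S. u c * c ij) = 0" for ij
  proof -
    have "(\<Sum>c\<in>S. u c * c ij) = cf (\<Sum>c\<in>S. scal (u c) (v c)) ij" using v by simp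
    then show ?thesis using u(2) by simp
  qed
  then show False using S(3) u(1) unfolding lin_indep_def by blast
qed

lemma ex_lin_indep:
  assumes "r \<le> card (leads (vanish X \<inter> below (triangle (Suc k))))"
  obtains S where "finite S" "S \<subseteq> vanishing k X" "lin_indep S" "card S = r"
proof -
  let ?V = "vanish X \<inter> below (triangle (Suc k))"
  obtain L where L: "L \<subseteq> leads ?V" "card L = r" "finite L"
    using obtain_subset_with_card_n[OF assms] by metis
  have "\<forall>l\<in>L. \<exists>p. p \<in> ?V \<and> p \<in> below (Suc l) \<and> cf p (prod_decode l) \<noteq> 0"
    using L(1) unfolding leads_def by blast
  then obtain b where b: "\<And>l. l \<in> L \<Longrightarrow> b l \<in> ?V \<and> b l \<in> below (Suc l) \<and> cf (b l) (prod_decode l) \<noteq> 0"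
    by metis
  have inj: "inj_on (\<lambda>l. cf (b l)) L"
  proof (rule inj_onI)
    fix l l' assume l: "l \<in> L" "l' \<in> L" "cf (b l) = cf (b l')"
    then have "b l = b l'" by (simp add: cf_eq_iff)
    then have "lead (b l) (prod_decode l)" "lead (b l) (prod_decode l')"
      using b[OF l(1)] b[OF l(2)] by (auto simp: lead_def)
    then show "l = l'" using lead_unique by fastforce
  qed
  have "lin_indep ((\<lambda>l. cf (b l)) ` L)"
    unfolding lin_indep_def
  proof (intro allI impI)
    fix u assume u: "\<forall>ij. (\<Sum>p\<in>(\<lambda>l. cf (b l)) ` L. u p * p ij) = 0"
    have "(\<Sum>l\<in>L. u (cf (b l)) * cf (b l) ij) = 0" for ij
      using u[rule_format, of ij] by (simp add: sum.reindex[OF inj] o_def)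
    then have "\<forall>l\<in>L. u (cf (b l)) = 0"
      using independent_of_distinct_leads[of L b "\<lambda>l. u (cf (b l))"] L(3) b by blast
    then show "\<forall>p\<in>(\<lambda>l. cf (b l)) ` L. u p = 0" by blast
  qed
  moreover have "(\<lambda>l. cf (b l)) ` L \<subseteq> vanishing k X"
    using b cf_in_vanishing_iff by blast
  ultimately show thesis using that[of "(\<lambda>l. cf (b l)) ` L"] L inj by (simp add: card_image)
qed

text \<open>The polynomial is a product of lines, one through each node of \<open>W\<close>, all
  missing \<open>A\<close>.\<close>

lemma ex_separating_poly:
  assumes "finite W" "A \<notin> W"
  obtains p where "p \<in> below (triangle (Suc (card W)))" "ev p A = 1" "p \<in> vanish W"
proof -
  have "\<exists>p. p \<in> below (triangle (Suc (card W))) \<and> ev p A = 1 \<and> p \<in> vanish W"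
    using assms
  proof (induction W rule: finite_induct)
    case empty
    have "(1 :: real poly poly) \<in> below (triangle (Suc 0))"
      unfolding below_triangle_iff Pi_deg_def cf_def by (auto simp: one_pCons coeff_pCons split: nat.splits)
    then show ?case by (intro exI[of _ 1]) (simp add: vanish_def ev_def)
  next
    case (insert B W)
    then obtain p where p: "p \<in> below (triangle (Suc (card W)))" "ev p A = 1" "p \<in> vanish W" by auto
    \<comment> \<open>A horizontal or vertical line through \<open>B\<close>, chosen to avoid
      \<open>A\<close> and scaled to the value 1 there.\<close>
    obtain r s t where line: "r * fst A + s * snd A + t = 1" "r * fst B + s * snd B + t = 0"
    proof (cases "fst A = fst B")
      case True
      then have "snd A - snd B \<noteq> 0" using insert.prems by (auto simp: prod_eq_iff)
      then show thesis
        by (intro that[of 0 "1 / (snd A - snd B)" "- snd B / (snd A - snd B)"])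
          (simp_all add: diff_divide_distrib[symmetric] add_divide_distrib[symmetric])
    next
      case False
      then have "fst A - fst B \<noteq> 0" by simp
      then show thesis
        by (intro that[of "1 / (fst A - fst B)" 0 "- fst B / (fst A - fst B)"])
          (simp_all add: diff_divide_distrib[symmetric] add_divide_distrib[symmetric])
    qed
    define l where "l = [:[:t, s:], [:r:]:]"
    have "l \<in> below (triangle (Suc 1))"
      unfolding below_triangle_iff Pi_deg_def cf_def l_def by (auto simp: coeff_pCons split: nat.splits)
    then have "p * l \<in> below (triangle (Suc (card W + 1)))" using p(1) by (rule mult_below_triangle[rotated])
    moreover have "ev l A = 1" "ev l B = 0"
      using line by (simp_all add: ev_def l_def algebra_simps)
    ultimately show ?case using p insert.hyps
      by (intro exI[of _ "p * l"]) (auto simp: vanish_def)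
  qed
  then show thesis using that by blast
qed

text \<open>Products of \<open>n\<close> lines separate each node from the other \<open>n\<close>.
  This will be applied to four nodes and cubics.\<close>

lemma n_independent_of_card_eq_Suc:
  assumes "finite Z" "card Z = Suc n"
  shows "n_independent n Z"
  unfolding n_independent_def
proof
  fix A assume "A \<in> Z"
  then have "card (Z - {A}) = n" using assms by simp
  then obtain p where "p \<in> below (triangle (Suc n))" "ev p A = 1" "p \<in> vanish (Z - {A})"
    using ex_separating_poly[of "Z - {A}" A] assms(1) by auto
  then have "fundamental n Z A (cf p)"
    by (auto simp: fundamental_def below_triangle_iff ev_eq_peval vanish_def)
  then show "\<exists>p. fundamental n Z A p" by blast
qed

text \<open>Polynomials of degree at most m form a space of dimension
  \<open>triangle (Suc m)\<close>, so this ties the closed formula for d(n, j) to a difference of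
  dimensions; doubling disposes of the \<open>div\<close>.\<close>

lemma d_nk_add_triangle:
  assumes "j \<le> n"
  shows "d_nk n j + triangle (Suc (n - j)) = triangle (Suc n)"
proof -
  obtain r where r: "n = j + r" using assms le_Suc_ex by blast
  have two: "2 * triangle m = m * Suc m" for m
    by (induction m) (auto simp: triangle_Suc)
  have "2 * triangle (Suc n) = j * (2 * n + 3 - j) + 2 * triangle (Suc r)"
    unfolding two r by (simp add: algebra_simps)
  moreover have "even (j * (2 * n + 3 - j))"
    by (metis calculation dvd_triv_left even_add)
  ultimately show ?thesis unfolding d_nk_def r by (auto elim!: evenE)
qed

section \<open>Common components\<close>

lemma cf_varx_mult: "cf (varx * p) (Suc i, j) = cf p (i, j)"
  by (simp add: cf_def)

lemma cf_vary_mult: "cf (vary * p) (i, Suc j) = cf p (i, j)"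
  by (simp add: cf_def)

lemma prod_encode_Suc: "Suc (prod_encode (i, Suc j)) = prod_encode (Suc i, j)"
  by (simp add: prod_encode_def)

lemma scal_eq_mult: "scal r p = [:[:r:]:] * p"
  by (simp add: scal_def)

lemma diff_scal_below:
  assumes "r \<in> below (Suc (prod_encode ij))" "cf r ij = 1" "w \<in> below (Suc (prod_encode ij))"
  shows "w - scal (cf w ij) r \<in> below (prod_encode ij)"
proof (rule below_SucD)
  show "w - scal (cf w ij) r \<in> below (Suc (prod_encode ij))"
    using assms by (intro bp.subspace_diff bp.subspace_scale subspace_below)
  show "cf (w - scal (cf w ij) r) (prod_decode (prod_encode ij)) = 0"
    using assms by simp
qed

lemma exps_obtain_monic:
  assumes "i \<in> exps X (i + j)"
  obtains p where "p \<in> vanish X" "p \<in> below (Suc (prod_encode (i, j)))" "cf p (i, j) = 1"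
proof -
  obtain p where p: "p \<in> vanish X" "lead p (i, j)" using assms by (auto simp: exps_iff)
  let ?p = "scal (1 / cf p (i, j)) p"
  show thesis
  proof
    show "?p \<in> vanish X" using p(1) by (intro bp.subspace_scale subspace_vanish)
    show "?p \<in> below (Suc (prod_encode (i, j)))"
      using p(2) unfolding lead_def by (intro bp.subspace_scale subspace_below) blast
    show "cf ?p (i, j) = 1" using p(2) by (simp add: lead_def)
  qed
qed

text \<open>\<open>triangle m\<close> bounds the degrees less than \<open>m\<close>, so the step to
  degree \<open>m\<close> only has to account for the leading monomials recorded in
  \<open>exps X m\<close>.\<close>

lemma vanish_below_subset:
  assumes U: "bp.subspace U" "U \<subseteq> vanish X"
    and m: "vanish X \<inter> below (triangle m) \<subseteq> U"
    and exps: "\<And>i. i \<in> exps X m \<Longrightarrow> \<exists>p\<in>U. lead p (i, m - i)"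
  shows "vanish X \<inter> below (triangle (Suc m)) \<subseteq> U"
proof (rule subset_of_leads_subset[OF subspace_vanish U])
  show "leads (vanish X) \<inter> {..<triangle (Suc m)} \<subseteq> leads U"
  proof
    fix l assume l: "l \<in> leads (vanish X) \<inter> {..<triangle (Suc m)}"
    show "l \<in> leads U"
    proof (cases "l < triangle m")
      case True
      then show ?thesis
        using l leads_Int_below[of "vanish X" "triangle m"] leads_mono[OF m] by blast
    next
      case False
      define i where "i = l - triangle m"
      have i: "i \<le> m" "l = prod_encode (i, m - i)"
        using False l by (auto simp: i_def triangle_Suc prod_encode_def)
      then have "i \<in> exps X m" using l by (simp add: exps_def)
      then show ?thesis using exps i leads_iff by blast
    qed
  qed
qed

lemma vanish_below_eq_0:
  assumes "(\<Sum>i<m. card (exps X i)) = 0"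
  shows "vanish X \<inter> below (triangle m) \<subseteq> {0}"
proof (rule subset_of_leads_subset[OF subspace_vanish])
  have "card (leads (vanish X) \<inter> {..<triangle m}) = 0" using assms card_leads_vanish by simp
  then show "leads (vanish X) \<inter> {..<triangle m} \<subseteq> leads {0}" by simp
qed (auto simp: bp.subspace_def bp.subspace_0[OF subspace_vanish])

lemma subspace_multiples: "bp.subspace V \<Longrightarrow> bp.subspace {v \<in> V. q dvd v}"
  by (auto simp: bp.subspace_def scal_def dvd_smult)

text \<open>Growth from 3 to 4 leaves no gap between the leading monomials. After correction,
  neighbouring polynomials give differences y p1 - x p0 and y p2 - x p1 of degree at most
  \<open>k + 2\<close>, that is, linear syzygies.\<close>

lemma common_curve_of_growth_3:
  assumes zero: "(\<Sum>i<k + 2. card (exps X i)) = 0"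
    and e: "card (exps X (k + 2)) = 3" "card (exps X (k + 3)) = 4"
  obtains q i j where "lead q (i, j)" "i + j = k"
    "\<And>v. v \<in> vanish X \<inter> below (triangle (Suc (k + 3))) \<Longrightarrow> q dvd v"
proof -
  have S3: "k + 3 = Suc (k + 2)" by simp
  have "exps X (k + 2) \<noteq> {}" using e(1) by auto
  then obtain a where a: "exps X (k + 2) = {a..<a + 3}" "exps X (k + 3) = {a..a + 3}"
    using interval_of_card_Un_Suc_image[OF _ _ exps_Suc[of X "k + 2"]] e unfolding S3
    by (metis finite_exps Suc_eq_plus1 numeral_eq_Suc pred_numeral_simps(2) semiring_norm(26,27,28)
        numeral_plus_one)
  \<comment> \<open>The leading monomials of degree \<open>k + 2\<close> are x^a y^(b+2), x^(a+1)
    y^(b+1) and x^(a+2) y^b with a + b = k.\<close>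
  have "a + 2 \<in> exps X (k + 2)" using a by simp
  then have "a \<le> k" by (simp add: exps_iff)
  then obtain b where k: "k = a + b" using le_Suc_ex by blast
  note SS = numeral_2_eq_2 numeral_3_eq_3
  have in1: "a \<in> exps X (a + Suc (Suc b))" "Suc a \<in> exps X (Suc a + Suc b)"
    "Suc (Suc a) \<in> exps X (Suc (Suc a) + b)"
    using a(1) unfolding k by (simp_all add: SS)
  obtain p0 where p0: "p0 \<in> vanish X" "p0 \<in> below (Suc (prod_encode (a, Suc (Suc b))))"
      "cf p0 (a, Suc (Suc b)) = 1"
    using exps_obtain_monic[OF in1(1)] by blast
  obtain p1' where p1': "p1' \<in> vanish X" "p1' \<in> below (Suc (prod_encode (Suc a, Suc b)))"
      "cf p1' (Suc a, Suc b) = 1"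
    using exps_obtain_monic[OF in1(2)] by blast
  obtain p2' where p2': "p2' \<in> vanish X" "p2' \<in> below (Suc (prod_encode (Suc (Suc a), b)))"
      "cf p2' (Suc (Suc a), b) = 1"
    using exps_obtain_monic[OF in1(3)] by blast
  have x_below: "varx * p \<in> below (Suc (prod_encode (Suc i, j)))"
    and y_below: "vary * p \<in> below (Suc (prod_encode (i, Suc j)))"
    if "p \<in> below (Suc (prod_encode (i, j)))" "cf p (i, j) = 1" for p i j
    using that lead_mult[OF lead_varx, of p i j] lead_mult[OF lead_vary, of p i j]
    unfolding lead_def by auto
  \<comment> \<open>The smallest leading monomial of degree \<open>k + 3\<close> is x^a y^(b+3), so
    an element of the ideal below it already has degree at most \<open>k + 2\<close>.\<close>
  have drop: "w \<in> below (triangle (Suc (k + 2)))"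
    if w: "w \<in> vanish X" "w \<in> below (prod_encode (a, Suc (Suc (Suc b))))" for w
  proof -
    let ?U = "vanish X \<inter> below (triangle (Suc (k + 2)))"
    have "vanish X \<inter> below (prod_encode (a, Suc (Suc (Suc b)))) \<subseteq> ?U"
    proof (rule subset_of_leads_subset[OF subspace_vanish subspace_vanish_below])
      have enc: "prod_encode (a, Suc (Suc (Suc b))) = triangle (Suc (k + 2)) + a"
        by (simp add: prod_encode_def k)
      show "leads (vanish X) \<inter> {..<prod_encode (a, Suc (Suc (Suc b)))} \<subseteq> leads ?U"
        unfolding leads_Int_below enc
      proof
        fix l assume l: "l \<in> leads (vanish X) \<inter> {..<triangle (Suc (k + 2)) + a}"
        have "l < triangle (Suc (k + 2))"
        proof (rule ccontr)
          assume n: "\<not> l < triangle (Suc (k + 2))"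
          define i where "i = l - triangle (Suc (k + 2))"
          have i: "i < a" "l = triangle (Suc (k + 2)) + i" using l n by (auto simp: i_def)
          then have "prod_encode (i, k + 3 - i) = l" using \<open>a \<le> k\<close> by (simp add: prod_encode_def numeral_3_eq_3)
          then have "i \<in> exps X (k + 3)" using l i \<open>a \<le> k\<close> by (simp add: exps_def)
          then show False using a(2) i by simp
        qed
        then show "l \<in> leads (vanish X) \<inter> {..<triangle (Suc (k + 2))}" using l by simp
      qed
    qed blast
    then show ?thesis using w by blast
  qed
  have sub: "p - scal r q \<in> vanish X" if "p \<in> vanish X" "q \<in> vanish X" for p q r
    using that by (intro bp.subspace_diff bp.subspace_scale subspace_vanish)
  have diff: "p - q \<in> vanish X" if "p \<in> vanish X" "q \<in> vanish X" for p q
    using that by (intro bp.subspace_diff subspace_vanish)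
  have cancel: "p - q \<in> below (prod_encode ij)"
    if "p \<in> below (Suc (prod_encode ij))" "cf p ij = 1" "q \<in> below (Suc (prod_encode ij))" "cf q ij = 1"
    for p q ij
    using diff_scal_below[of q ij p] that by simp
  have sub_monic: "p - scal r q \<in> below (Suc (prod_encode ij)) \<and> cf (p - scal r q) ij = 1"
    if "p \<in> below (Suc (prod_encode ij))" "cf p ij = 1" "q \<in> below (prod_encode ij)" for p q r ij
  proof
    have "q \<in> below (Suc (prod_encode ij))" using that(3) below_mono[of "prod_encode ij" "Suc (prod_encode ij)"] by auto
    then show "p - scal r q \<in> below (Suc (prod_encode ij))"
      using that(1) by (intro bp.subspace_diff bp.subspace_scale subspace_below)
    show "cf (p - scal r q) ij = 1" using that(2) belowD[OF that(3)] by simp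
  qed
  \<comment> \<open>Correct the middle and the top polynomial by lower ones so that the degree-raising relations close up in
    degree \<open>k + 2\<close>, which turns them into linear syzygies.\<close>
  have "vary * p1' - varx * p0 \<in> below (prod_encode (Suc a, Suc (Suc b)))"
    using p0 p1' x_below[OF p0(2,3)] y_below[OF p1'(2,3)] by (intro cancel) (simp_all only: cf_varx_mult cf_vary_mult)
  then have w1: "vary * p1' - varx * p0 \<in> below (Suc (prod_encode (a, Suc (Suc (Suc b)))))"
    by (simp only: prod_encode_Suc)
  have y0: "vary * p0 \<in> below (Suc (prod_encode (a, Suc (Suc (Suc b)))))" "cf (vary * p0) (a, Suc (Suc (Suc b))) = 1"
    using y_below[OF p0(2,3)] p0(3) by (simp_all only: cf_vary_mult)
  \<comment> \<open>The coefficient at the lead of \<open>vary * p0\<close>: subtracting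
    \<open>scal \<kappa> p0\<close> from \<open>p1'\<close> cancels it in the relation and keeps the
    lead of \<open>p1'\<close>.\<close>
  define \<kappa> where "\<kappa> = cf (vary * p1' - varx * p0) (a, Suc (Suc (Suc b)))"
  define p1 where "p1 = p1' - scal \<kappa> p0"
  have p1: "p1 \<in> vanish X" "p1 \<in> below (Suc (prod_encode (Suc a, Suc b)))" "cf p1 (Suc a, Suc b) = 1"
    using sub[OF p1'(1) p0(1)] sub_monic[OF p1'(2,3), of p0 \<kappa>] p0(2)
    unfolding p1_def prod_encode_Suc by blast+
  have "vary * p1 - varx * p0 = (vary * p1' - varx * p0) - scal \<kappa> (vary * p0)"
    by (simp only: p1_def right_diff_distrib scal_mult_right diff_right_commute)
  then have "vary * p1 - varx * p0 \<in> below (prod_encode (a, Suc (Suc (Suc b))))"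
    using diff_scal_below[OF y0 w1] unfolding \<kappa>_def[symmetric] by (simp only:)
  then have s1: "vary * p1 - varx * p0 \<in> vanish X \<inter> below (triangle (Suc (k + 2)))"
    using drop diff vanish_mult(1) p1(1) p0(1) by blast
  have "vary * p2' - varx * p1 \<in> below (prod_encode (Suc (Suc a), Suc b))"
    using p1 p2' x_below[OF p1(2,3)] y_below[OF p2'(2,3)] by (intro cancel) (simp_all only: cf_varx_mult cf_vary_mult)
  then have w2: "vary * p2' - varx * p1 \<in> below (Suc (prod_encode (Suc a, Suc (Suc b))))"
    by (simp only: prod_encode_Suc)
  have y1: "vary * p1 \<in> below (Suc (prod_encode (Suc a, Suc (Suc b))))" "cf (vary * p1) (Suc a, Suc (Suc b)) = 1"
    using y_below[OF p1(2,3)] p1(3) by (simp_all only: cf_vary_mult)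
  \<comment> \<open>The second relation has two possible leads of degree \<open>k + 3\<close>, those
    of \<open>vary * p1\<close> and \<open>vary * p0\<close>; \<mu> and \<nu> remove them in
    turn.\<close>
  define \<mu> where "\<mu> = cf (vary * p2' - varx * p1) (Suc a, Suc (Suc b))"
  have w3: "(vary * p2' - varx * p1) - scal \<mu> (vary * p1) \<in> below (Suc (prod_encode (a, Suc (Suc (Suc b)))))"
    using diff_scal_below[OF y1 w2] unfolding \<mu>_def[symmetric] by (simp only: prod_encode_Suc)
  define \<nu> where "\<nu> = cf ((vary * p2' - varx * p1) - scal \<mu> (vary * p1)) (a, Suc (Suc (Suc b)))"
  define p2 where "p2 = p2' - scal \<mu> p1 - scal \<nu> p0"
  have p2'': "p2' - scal \<mu> p1 \<in> below (Suc (prod_encode (Suc (Suc a), b)))" "cf (p2' - scal \<mu> p1) (Suc (Suc a), b) = 1"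
    using sub_monic[OF p2'(2,3), of p1 \<mu>] p1(2) unfolding prod_encode_Suc by blast+
  have "p0 \<in> below (prod_encode (Suc (Suc a), b))"
  proof -
    have "Suc (prod_encode (a, Suc (Suc b))) \<le> prod_encode (Suc (Suc a), b)"
      using prod_encode_Suc[of a "Suc b"] prod_encode_Suc[of "Suc a" b] by linarith
    then show ?thesis using p0(2) below_mono by blast
  qed
  then have p2: "p2 \<in> vanish X" "p2 \<in> below (Suc (prod_encode (Suc (Suc a), b)))" "cf p2 (Suc (Suc a), b) = 1"
    using sub[OF sub[OF p2'(1) p1(1)] p0(1)] sub_monic[OF p2'', of p0 \<nu>]
    unfolding p2_def by blast+
  have "vary * p2 - varx * p1 = ((vary * p2' - varx * p1) - scal \<mu> (vary * p1)) - scal \<nu> (vary * p0)"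
    by (simp only: p2_def right_diff_distrib scal_mult_right)
  then have "vary * p2 - varx * p1 \<in> below (prod_encode (a, Suc (Suc (Suc b))))"
    using diff_scal_below[OF y0 w3] unfolding \<nu>_def[symmetric] by (simp only:)
  then have s2: "vary * p2 - varx * p1 \<in> vanish X \<inter> below (triangle (Suc (k + 2)))"
    using drop diff vanish_mult(1) p2(1) p1(1) by blast
  have leads: "lead p0 (a, Suc (Suc b))" "lead p1 (Suc a, Suc b)" "lead p2 (Suc (Suc a), b)"
    using p0 p1 p2 by (auto simp: lead_def)
  have below_m: "vanish X \<inter> below (triangle (k + 2)) \<subseteq> {0}"
    using zero by (rule vanish_below_eq_0)
  have exps_m: "\<exists>p\<in>{p0, p1, p2}. lead p (i, k + 2 - i)" if "i \<in> exps X (k + 2)" for i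
  proof -
    from that a(1) consider "i = a" | "i = Suc a" | "i = Suc (Suc a)" by fastforce
    then show ?thesis using leads k by cases auto
  qed
  \<comment> \<open>No nonzero element of the ideal has degree less than \<open>k + 2\<close>, so
    three polynomials with the right leads suffice.\<close>
  have span: "vanish X \<inter> below (triangle (Suc (k + 2))) \<subseteq> bp.span {p0, p1, p2}"
  proof (rule vanish_below_subset)
    show "bp.span {p0, p1, p2} \<subseteq> vanish X"
      using p0(1) p1(1) p2(1) by (intro bp.span_minimal subspace_vanish) blast
    show "vanish X \<inter> below (triangle (k + 2)) \<subseteq> bp.span {p0, p1, p2}"
      using below_m bp.span_zero by blast
    show "\<exists>p\<in>bp.span {p0, p1, p2}. lead p (i, k + 2 - i)" if "i \<in> exps X (k + 2)" for i
      using exps_m[OF that] bp.span_superset[of "{p0, p1, p2}"] by (meson subsetD)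
  qed simp
  have comb: "\<exists>\<alpha> \<beta> \<gamma>. w = scal \<alpha> p2 + scal \<beta> p1 + scal \<gamma> p0"
    if "w \<in> vanish X \<inter> below (triangle (Suc (k + 2)))" for w
  proof -
    have "w \<in> bp.span {p2, p1, p0}" 
    proof -
      have "{p0, p1, p2} = {p2, p1, p0}" by blast
      then show ?thesis using subsetD[OF span that] by (simp only:)
    qed
    then obtain \<alpha> \<beta> where "w - scal \<alpha> p2 - scal \<beta> p1 \<in> bp.span {p0}"
      by (metis bp.span_breakdown_eq)
    then obtain \<gamma> where "w - scal \<alpha> p2 - scal \<beta> p1 = scal \<gamma> p0"
      unfolding bp.span_singleton by (rule rangeE)
    then have "w = scal \<alpha> p2 + scal \<beta> p1 + scal \<gamma> p0" by (simp add: algebra_simps)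
    then show ?thesis by blast
  qed
  obtain \<alpha> \<beta> \<gamma> where r1: "vary * p1 - varx * p0 = scal \<alpha> p2 + scal \<beta> p1 + scal \<gamma> p0"
    using comb[OF s1] by blast
  obtain \<alpha>' \<beta>' \<gamma>' where r2: "vary * p2 - varx * p1 = scal \<alpha>' p2 + scal \<beta>' p1 + scal \<gamma>' p0"
    using comb[OF s2] by blast
  \<comment> \<open>Both relations are moved to one side: the coefficients have degree at most 1, so
    their minors are conics.\<close>
  define A B C A' B' C' where "A = [:[:\<alpha>:]:]" and "B = [:[:\<beta>:]:] - vary" and "C = [:[:\<gamma>:]:] + varx"
    and "A' = [:[:\<alpha>':]:] - vary" and "B' = [:[:\<beta>':]:] + varx" and "C' = [:[:\<gamma>':]:]"
  have R: "A * p2 + B * p1 + C * p0 = 0" "A' * p2 + B' * p1 + C' * p0 = 0"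
    using r1 r2 unfolding scal_eq_mult A_def B_def C_def A'_def B'_def C'_def left_diff_distrib distrib_right
    by (simp_all only: diff_eq_eq algebra_simps)
  define M0 where "M0 = A * B' - B * A'"
  define s w u where "s = [:\<alpha> * \<beta>' - \<beta> * \<alpha>', \<beta> + \<alpha>', - 1:]"
    and "w = [:\<gamma> * \<beta>' - \<beta> * \<gamma>', \<gamma>':]" and "u = [:\<gamma> + \<beta>':]"
  have M0: "M0 = [:s, [:\<alpha>:]:]"
    by (simp add: M0_def A_def B_def A'_def B'_def s_def algebra_simps)
  have M2: "B * C' - C * B' = - [:w, u, 1:]"
    by (simp add: B_def C_def B'_def C'_def w_def u_def algebra_simps)
  have M02: "M0 * p2 = - [:w, u, 1:] * p0"
    using linear_relations_cross_product(1)[OF R] unfolding M0_def M2 .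
  have M01: "M0 * p1 = (C * A' - A * C') * p0"
    using linear_relations_cross_product(2)[OF R] unfolding M0_def .
  have "[:s, [:\<alpha>:]:] * p2 = [:w, u, 1:] * (- p0)"
    using M02 unfolding M0 by (simp only: mult_minus_left mult_minus_right)
  then obtain q where q: "p2 = [:w, u, 1:] * q" "- p0 = [:s, [:\<alpha>:]:] * q"
    by (rule common_cofactor_of_conics[rotated 4]) (auto simp: w_def u_def s_def)
  have p0q: "p0 = M0 * (- q)" using q(2) M0 by (metis minus_minus mult_minus_right)
  have "lead M0 (0, 2)"
  proof -
    have "cf M0 (i, j) = 0" if "prod_encode (0, 2) < prod_encode (i, j)" for i j
      using that unfolding prod_encode_less_iff M0 s_def
      by (auto simp: cf_def coeff_pCons split: nat.splits)
    moreover have "cf M0 (0, 2) \<noteq> 0" by (simp add: M0 s_def cf_def numeral_2_eq_2)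
    ultimately show ?thesis by (auto simp: lead_def below_def Suc_le_eq)
  qed
  then have "M0 \<noteq> 0" by (rule lead_nonzero)
  have "q \<noteq> 0" using p0q lead_nonzero[OF leads(1)] by auto
  \<comment> \<open>The lead y^2 of \<open>M0\<close> accounts for two of the \<open>k + 2\<close>
    degrees of \<open>p0\<close>, which leaves \<open>k\<close> for the cofactor.\<close>
  then obtain i j where ij: "lead (- q) (i, j)" using ex_lead[of "- q"] by auto
  then have "lead p0 (0 + i, 2 + j)" unfolding p0q using \<open>lead M0 (0, 2)\<close> lead_mult by blast
  then have "(0 + i, 2 + j) = (a, Suc (Suc b))" using leads(1) lead_unique by blast
  then have "i + j = k" using k by simp
  have "M0 * p1 = M0 * ((C * A' - A * C') * (- q))"
    unfolding M01 by (subst p0q) (simp only: mult.left_commute)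
  then have p1q: "p1 = (C * A' - A * C') * (- q)" using \<open>M0 \<noteq> 0\<close> by (metis mult_left_cancel)
  have dvd: "- q dvd p0" "- q dvd p1" "- q dvd p2"
    using p0q p1q q(1) by (metis dvd_triv_right minus_dvd_iff)+
  show thesis
  proof
    show "lead (- q) (i, j)" "i + j = k" by fact+
    let ?U = "{v \<in> vanish X. - q dvd v}"
    have U: "bp.subspace ?U" by (intro subspace_multiples subspace_vanish)
    have "bp.span {p0, p1, p2} \<subseteq> ?U"
      using p0(1) p1(1) p2(1) dvd by (intro bp.span_minimal U) blast
    \<comment> \<open>In degree \<open>k + 3\<close> the four leads are attained by y p0, y p1, y p2
      and x p2, all of them multiples of \<open>q\<close>.\<close>
    have "vanish X \<inter> below (triangle (Suc (k + 3))) \<subseteq> ?U"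
    proof (rule vanish_below_subset[OF U])
      show "vanish X \<inter> below (triangle (k + 3)) \<subseteq> ?U"
        using span \<open>bp.span {p0, p1, p2} \<subseteq> ?U\<close> unfolding S3 by blast
      fix i assume "i \<in> exps X (k + 3)"
      with a(2) consider "i = a" | "i = Suc a" | "i = Suc (Suc a)" | "i = Suc (Suc (Suc a))" by fastforce
      then show "\<exists>p\<in>?U. lead p (i, k + 3 - i)"
      proof cases
        case 1
        have "lead (vary * p0) (i, k + 3 - i)"
          using lead_mult[OF lead_vary leads(1)] 1 k by (simp add: numeral_3_eq_3 del: mult_pCons_left)
        then show ?thesis using p0(1) dvd(1) vanish_mult(1) dvd_mult by blast
      next
        case 2
        have "lead (vary * p1) (i, k + 3 - i)"
          using lead_mult[OF lead_vary leads(2)] 2 k by (simp add: numeral_3_eq_3 del: mult_pCons_left)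
        then show ?thesis using p1(1) dvd(2) vanish_mult(1) dvd_mult by blast
      next
        case 3
        have "lead (vary * p2) (i, k + 3 - i)"
          using lead_mult[OF lead_vary leads(3)] 3 k by (simp add: numeral_3_eq_3 del: mult_pCons_left)
        then show ?thesis using p2(1) dvd(3) vanish_mult(1) dvd_mult by blast
      next
        case 4
        have "lead (varx * p2) (i, k + 3 - i)"
          using lead_mult[OF lead_varx leads(3)] 4 k by (simp add: numeral_3_eq_3 del: mult_pCons_left)
        then show ?thesis using p2(1) dvd(3) vanish_mult(1) dvd_mult by blast
      qed
    qed blast
    then show "- q dvd v" if "v \<in> vanish X \<inter> below (triangle (Suc (k + 3)))" for v
      using that by blast
  qed
qed

lemma common_curve_of_growth_1_2:
  assumes zero: "(\<Sum>i<k + 1. card (exps X i)) = 0"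
    and e: "card (exps X (k + 1)) = 1" "card (exps X (k + 2)) = 2"
      "card (exps X (k + 3)) = 4" "card (exps X (k + 4)) = 5"
  obtains q i j where "lead q (i, j)" "i + j = k"
    "\<And>v. v \<in> vanish X \<inter> below (triangle (Suc (k + 3))) \<Longrightarrow> q dvd v"
proof -
  let ?V = "vanish X \<inter> below (triangle (Suc (k + 3)))"
  have card3: "card (leads ?V) = 7" and card4: "card (leads (vanish X) \<inter> {..<triangle (Suc (k + 4))}) = 12"
    using zero e unfolding leads_Int_below card_leads_vanish by (simp_all add: eval_nat_numeral)
  obtain f0 where "f0 \<in> exps X (k + 1)" using e(1) by (metis card.empty ex_in_conv zero_neq_one)
  then obtain f i j where f: "f \<in> vanish X" "lead f (i, j)" "i + j = k + 1"
    unfolding exps_iff by (metis le_add_diff_inverse)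
  have "f \<noteq> 0" using f(2) by (rule lead_nonzero)
  have fk: "f \<in> below (triangle (Suc (k + 1)))" using lead_below_triangle_iff[OF f(2)] f(3) by simp
  let ?U = "(*) f ` below (triangle (Suc 2))"
  have U: "bp.subspace ?U" by (intro subspace_mult subspace_below)
  have cardU: "card (leads ?U) = 6"
    unfolding card_leads_mult[OF \<open>f \<noteq> 0\<close>] leads_below by (simp add: eval_nat_numeral triangle_Suc)
  have f_cofactor: "c \<in> below (triangle (Suc 2))" if "f * c \<in> ?V" for c
    using cofactor_below_triangle[OF f(2), of c 2] that f(3) by (simp add: numeral_eq_Suc)
  have UV: "?U \<subseteq> ?V"
    using mult_below_triangle[OF fk, of _ 2] vanish_mult(2)[OF f(1)] by (auto simp: numeral_eq_Suc)
  \<comment> \<open>The multiples of \<open>f\<close> in \<open>?V\<close> have dimension 6, one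
    less than \<open>?V\<close>, so some \<open>p\<close> is not a multiple of
    \<open>f\<close>.\<close>
  have "?U \<noteq> ?V" using card3 cardU by auto
  then obtain p where p: "p \<in> ?V" "p \<notin> ?U" using UV by blast
  have p_not_mult: "p \<noteq> f * c" for c using p f_cofactor by blast
  \<comment> \<open>Cubic multiples of \<open>f\<close> and linear multiples of \<open>p\<close>
    supply 10 + 3 products in a space of dimension 12, which forces a syzygy.\<close>
  have "card (leads (vanish X) \<inter> {..<triangle (Suc (k + 4))}) < triangle (Suc 3) + triangle (Suc 1)"
    unfolding card4 by (simp add: eval_nat_numeral triangle_Suc)
  moreover have "f * c \<in> vanish X \<inter> below (triangle (Suc (k + 4)))" if "c \<in> below (triangle (Suc 3))" for c
    using mult_below_triangle[OF fk that] vanish_mult(2)[OF f(1)] by (simp add: numeral_eq_Suc)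
  moreover have "p * c \<in> vanish X \<inter> below (triangle (Suc (k + 4)))" if "c \<in> below (triangle (Suc 1))" for c
    using mult_below_triangle[of p "k + 3" c 1] that p(1) vanish_mult(2)[of p X c] by (simp add: numeral_eq_Suc)
  ultimately obtain c d where cd: "c \<in> below (triangle (Suc 3))" "d \<in> below (triangle (Suc 1))"
      "c \<noteq> 0 \<or> d \<noteq> 0" "f * c + p * d = 0"
    using ex_syzygy[OF subspace_vanish, of "triangle (Suc 3)" f X "triangle (Suc (k + 4))"
        "triangle (Suc 1)" p] by metis
  \<comment> \<open>A nonzero constant \<open>d\<close> would make \<open>p\<close> a multiple of
    \<open>f\<close>, and \<open>d = 0\<close> would make \<open>f * c\<close> vanish with
    \<open>c\<close> nonzero.\<close>
  have d0: "d \<notin> below (triangle (Suc 0))"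
  proof
    assume "d \<in> below (triangle (Suc 0))"
    then obtain r where r: "d = [:[:r:]:]" by (rule below_triangle_1E)
    show False
    proof (cases "r = 0")
      case True
      then have "d = 0" by (simp add: r)
      then show False using cd(3,4) \<open>f \<noteq> 0\<close> by simp
    next
      case False
      have "f * c + scal r p = 0" using cd(4) by (simp add: r scal_eq_mult mult.commute)
      then have "scal (- 1 / r) (f * c + scal r p) = 0" by simp
      then have "p = f * scal (- 1 / r) c"
        using False by (simp add: bp.scale_right_distrib)
      then show False using p_not_mult by blast
    qed
  qed
  have "d dvd f * c" using cd(4) by (metis dvd_triv_right add.commute add_eq_0_iff dvd_minus_iff)
  \<comment> \<open>As a line, \<open>d\<close> is prime. If it divided \<open>c\<close>, cancelling
    it would leave \<open>p\<close> as a multiple of \<open>f\<close>.\<close>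
  then consider "d dvd c" | "d dvd f"
    using prime_elem_line[OF cd(2) d0] prime_elem_dvd_multD by blast
  then have "d dvd f"
  proof cases
    case 1
    then obtain c' where c': "c = d * c'" by (rule dvdE)
    have "d * (f * c' + p) = 0" using cd(4) unfolding c' by (simp add: algebra_simps)
    moreover have "d \<noteq> 0" using d0 bp.subspace_0[OF subspace_below] by blast
    ultimately have "p = f * (- c')" by (simp add: add_eq_0_iff2 add.commute)
    then show ?thesis using p_not_mult by blast
  qed
  then obtain q where fq: "f = d * q" by (rule dvdE)
  have "d \<noteq> 0" "q \<noteq> 0" using \<open>f \<noteq> 0\<close> fq by auto
  then obtain i1 j1 i2 j2 where l: "lead d (i1, j1)" "lead q (i2, j2)" by (metis ex_lead)
  have "i1 + j1 = 1"
    using lead_below_triangle_iff[OF l(1)] cd(2) d0 by (metis One_nat_def Suc_leI le_antisym not_le less_one)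
  moreover have "(i, j) = (i1 + i2, j1 + j2)" using lead_unique f(2) lead_mult[OF l] unfolding fq by blast
  ultimately have "i2 + j2 = k" using f(3) by simp
  have "d * (q * c + p) = 0" using cd(4) unfolding fq by (simp add: algebra_simps)
  then have "p = q * (- c)" using \<open>d \<noteq> 0\<close> by (simp add: add_eq_0_iff2 add.commute)
  then have qp: "q dvd p" by (rule dvdI)
  \<comment> \<open>The multiples of \<open>q\<close> in \<open>?V\<close> contain \<open>?U\<close>
    and also \<open>p\<close>, so their dimension is at least 7.\<close>
  let ?W = "{v \<in> ?V. q dvd v}"
  have W: "bp.subspace ?W" by (intro subspace_multiples subspace_vanish_below)
  have "?U \<subseteq> ?W" using UV fq by auto
  have fin: "?W \<subseteq> below (triangle (Suc (k + 3)))" by blast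
  have "\<not> card (leads ?W) \<le> card (leads ?U)"
    using subspace_eq_of_card_leads_le[OF W U \<open>?U \<subseteq> ?W\<close> fin] p qp by blast
  then have "card (leads ?V) \<le> card (leads ?W)" using card3 cardU by simp
  then have "?W = ?V"
    by (intro subspace_eq_of_card_leads_le[OF subspace_vanish_below W, of _ _ "triangle (Suc (k + 3))"]) auto
  then show thesis using that[OF l(2) \<open>i2 + j2 = k\<close>] by blast
qed

section \<open>Maximal curves\<close>

text \<open>With n = k + 3 + Suc d, the number \<open>triangle (Suc d + 4)\<close> is the dimension
  of the polynomials of degree at most n - k; \<open>bound\<close> is what the independence of d(n,
  k) + 3 nodes yields.\<close>

lemma ex_common_curve:
  assumes bound: "card (leads (vanish X \<inter> below (triangle (Suc (k + 3 + Suc d))))) + 3 \<le> triangle (Suc d + 4)"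
    and ge: "7 \<le> card (leads (vanish X \<inter> below (triangle (Suc (k + 3)))))"
  shows "card (leads (vanish X \<inter> below (triangle (Suc (k + 3))))) = 7"
    and "\<exists>q i j. lead q (i, j) \<and> i + j = k \<and> (\<forall>v\<in>vanish X \<inter> below (triangle (Suc (k + 3))). q dvd v)"
proof -
  define e where "e m = card (exps X m)" for m
  have card: "card (leads (vanish X \<inter> below (triangle (Suc m)))) = (\<Sum>i\<le>m. e i)" for m
    unfolding leads_Int_below card_leads_vanish e_def lessThan_Suc_atMost ..
  have inc: "e m < e (Suc m)" if "0 < e m" for m
    using card_exps_less that unfolding e_def .
  note g = growth_dichotomy[of e, OF inc bound[unfolded card] ge[unfolded card]]
  show "card (leads (vanish X \<inter> below (triangle (Suc (k + 3))))) = 7"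
    using g(1) unfolding card .
  have less: "(\<Sum>i\<le>m. e i) = (\<Sum>i<m + 1. card (exps X i))" for m
    by (simp add: e_def lessThan_Suc_atMost)
  have k2: "k + 1 + 1 = k + 2" by simp
  from g(4) show "\<exists>q i j. lead q (i, j) \<and> i + j = k \<and> (\<forall>v\<in>vanish X \<inter> below (triangle (Suc (k + 3))). q dvd v)"
  proof
    assume "(\<Sum>i\<le>k + 1. e i) = 0 \<and> e (k + 2) = 3"
    then show ?thesis
      using common_curve_of_growth_3[of X k] g(3) unfolding less k2 unfolding e_def by metis
  next
    assume "(\<Sum>i\<le>k. e i) = 0 \<and> e (k + 1) = 1 \<and> e (k + 2) = 2"
    then show ?thesis
      using common_curve_of_growth_1_2[of X k] g(2,3) unfolding less unfolding e_def by metis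
  qed
qed

lemma total_degree_cf:
  assumes "lead q (i, j)"
  shows "total_degree (cf q) = i + j"
proof -
  have "cf q \<in> Pi_deg (i + j)"
    using lead_below_triangle_iff[OF assms] by (simp add: below_triangle_iff[symmetric])
  then show ?thesis
    unfolding total_degree_def Pi_deg_def
    using assms finite_imageI[OF finite_support_cf[of q], of "\<lambda>(i, j). i + j"]
    by (intro Max_eqI) (auto simp: lead_def image_def elim!: rev_finite_subset)
qed

text \<open>All multiples of \<open>q\<close> of degree at most \<open>n\<close> vanish on
  \<open>X\<close>, while independence bounds the dimension of such polynomials from above.\<close>

lemma card_on_curve_le:
  assumes "finite X" "n_independent n X" "lead q (i, j)" "i + j \<le> n" "\<And>A. A \<in> X \<Longrightarrow> ev q A = 0"
  shows "card X \<le> d_nk n (i + j)"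
proof -
  let ?U = "(*) q ` below (triangle (Suc (n - (i + j))))"
  have "q \<noteq> 0" using assms(3) by (rule lead_nonzero)
  have "q \<in> below (triangle (Suc (i + j)))" using lead_below_triangle_iff[OF assms(3)] by simp
  then have "?U \<subseteq> vanish X \<inter> below (triangle (Suc n))"
    using mult_below_triangle[of q "i + j" _ "n - (i + j)"] assms(4,5) by (auto simp: vanish_def)
  then have "card (leads ?U) \<le> card (leads (vanish X \<inter> below (triangle (Suc n))))"
    by (intro card_mono leads_mono finite_leads[of _ "triangle (Suc n)"]) auto
  moreover have "card (leads ?U) = triangle (Suc (n - (i + j)))"
    unfolding card_leads_mult[OF \<open>q \<noteq> 0\<close>] leads_below by simp
  ultimately show ?thesis
    using card_leads_vanish_le[OF assms(1,2)] d_nk_add_triangle[OF assms(4)] by linarith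
qed

lemma card_off_curve_le:
  assumes "finite X" "lead q (i, j)" "i + j = k"
    and dvd: "\<And>v. v \<in> vanish X \<inter> below (triangle (Suc (k + 3))) \<Longrightarrow> q dvd v"
    and card: "card (leads (vanish X \<inter> below (triangle (Suc (k + 3))))) = 7"
  shows "card {A \<in> X. ev q A \<noteq> 0} \<le> 3"
proof (rule ccontr)
  assume "\<not> ?thesis"
  \<comment> \<open>Exactly four nodes are kept: any four are independent for cubics, so the
    cofactors have dimension at most 10 - 4 = 6.\<close>
  then obtain Z where Z: "Z \<subseteq> {A \<in> X. ev q A \<noteq> 0}" "card Z = Suc 3" "finite Z"
    using obtain_subset_with_card_n[of "Suc 3" "{A \<in> X. ev q A \<noteq> 0}"] by auto
  let ?V = "vanish X \<inter> below (triangle (Suc (k + 3)))"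
  let ?W = "vanish Z \<inter> below (triangle (Suc 3))"
  have "q \<noteq> 0" using assms(2) by (rule lead_nonzero)
  have "?V \<subseteq> (*) q ` ?W"
  proof
    fix v assume v: "v \<in> ?V"
    then obtain c where c: "v = q * c" using dvd by blast
    have "c \<in> below (triangle (Suc 3))"
      using cofactor_below_triangle[OF assms(2), of c 3] v c assms(3) by simp
    moreover have "ev c A = 0" if "A \<in> Z" for A
    proof -
      have "ev q A * ev c A = 0" "ev q A \<noteq> 0" using v that Z(1) unfolding c by (auto simp: vanish_def)
      then show ?thesis by simp
    qed
    ultimately show "v \<in> (*) q ` ?W" using c by (auto simp: vanish_def)
  qed
  moreover have "finite (leads ((*) q ` ?W))"
  proof (rule finite_leads)
    have "q \<in> below (triangle (Suc k))" using lead_below_triangle_iff[OF assms(2)] assms(3) by simp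
    then show "(*) q ` ?W \<subseteq> below (triangle (Suc (k + 3)))"
      using mult_below_triangle[of q k _ 3] by blast
  qed
  ultimately have "7 \<le> card (leads ((*) q ` ?W))" using card_mono leads_mono card by metis
  also have "\<dots> = card (leads ?W)" by (rule card_leads_mult[OF \<open>q \<noteq> 0\<close>])
  finally have "7 \<le> card (leads ?W)" .
  moreover have "card (leads ?W) + card Z \<le> triangle (Suc 3)"
    using Z by (intro card_leads_vanish_le n_independent_of_card_eq_Suc)
  ultimately show False using Z(2) by (simp add: eval_nat_numeral triangle_Suc)
qed

text \<open>The dimension is expressed through finite linearly independent sets. A curve missing
  exactly three nodes passes through the other \<open>d_nk n (k - 3)\<close>, so it is
  maximal.\<close>

theorem mainTheorem1:
  fixes n k :: nat and X :: "(real \<times> real) set"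
  assumes "4 \<le> k" and "k \<le> n - 1"
    and "finite X" and "n_independent n X"
    and "card X = d_nk n (k - 3) + 3"
  shows "(\<forall>S. finite S \<and> S \<subseteq> vanishing k X \<and> lin_indep S \<longrightarrow> card S \<le> 7)
    \<and> ((\<exists>S. finite S \<and> S \<subseteq> vanishing k X \<and> lin_indep S \<and> card S = 7)
       \<longleftrightarrow> (\<exists>q. q \<in> Pi_deg (k - 3) \<and> q \<noteq> (\<lambda>_. 0) \<and> total_degree q = k - 3
              \<and> card {A \<in> X. peval q A \<noteq> 0} = 3))"
proof -
  define j where "j = k - 3"
  obtain d where d: "n = j + 3 + Suc d"
  proof -
    have "n = j + 3 + Suc (n - Suc k)" using assms(1,2) by (simp add: j_def)
    then show thesis by (rule that)
  qed
  have k: "k = j + 3" using assms(1) by (simp add: j_def)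
  let ?V = "vanish X \<inter> below (triangle (Suc (j + 3)))"
  have "n - j = Suc d + 3" using d by simp
  then have tri: "d_nk n j + triangle (Suc d + 4) = triangle (Suc n)"
    using d_nk_add_triangle[of j n] d by (simp add: eval_nat_numeral)
  have bound: "card (leads (vanish X \<inter> below (triangle (Suc (j + 3 + Suc d))))) + 3 \<le> triangle (Suc d + 4)"
    using card_leads_vanish_le[OF assms(3,4)] assms(5) tri unfolding j_def[symmetric] d by linarith
  note curve = ex_common_curve[OF bound]
  have "card (leads ?V) \<le> 7" using curve(1) by linarith
  then have upper: "card S \<le> 7" if "finite S" "S \<subseteq> vanishing k X" "lin_indep S" for S
    using card_le_card_leads_of_lin_indep[OF that] unfolding k by linarith
  have "\<exists>c. c \<in> Pi_deg j \<and> c \<noteq> (\<lambda>_. 0) \<and> total_degree c = j \<and> card {A \<in> X. peval c A \<noteq> 0} = 3"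
    if S: "finite S" "S \<subseteq> vanishing k X" "lin_indep S" "card S = 7" for S
  proof -
    have ge: "7 \<le> card (leads ?V)"
      using card_le_card_leads_of_lin_indep[OF S(1-3)] S(4) unfolding k by simp
    obtain q a b where q: "lead q (a, b)" "a + b = j" "\<forall>v\<in>?V. q dvd v"
      using curve(2)[OF ge] by blast
    define Y where "Y = {A \<in> X. ev q A = 0}"
    have "card {A \<in> X. ev q A \<noteq> 0} \<le> 3"
      using card_off_curve_le[OF assms(3) q(1,2)] q(3) curve(1)[OF ge] by blast
    moreover have "card Y \<le> d_nk n (a + b)"
    proof (rule card_on_curve_le[OF _ _ q(1)])
      show "finite Y" "n_independent n Y"
        using assms(3) n_independent_subset[OF assms(4), of Y] by (auto simp: Y_def)
      show "a + b \<le> n" using q(2) d by simp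
    qed (simp add: Y_def)
    moreover have "card X = card Y + card {A \<in> X. ev q A \<noteq> 0}"
    proof -
      have "X = Y \<union> {A \<in> X. ev q A \<noteq> 0}" by (auto simp: Y_def)
      moreover have "card (Y \<union> {A \<in> X. ev q A \<noteq> 0}) = card Y + card {A \<in> X. ev q A \<noteq> 0}"
        using assms(3) by (intro card_Un_disjoint) (auto simp: Y_def)
      ultimately show ?thesis by simp
    qed
    \<comment> \<open>At most \<open>d_nk n j\<close> nodes lie on the curve and at most three off
      it, while \<open>X\<close> has \<open>d_nk n j + 3\<close>; so both bounds are
      attained.\<close>
    ultimately have "card {A \<in> X. ev q A \<noteq> 0} = 3"
      using assms(5) unfolding j_def[symmetric] q(2) by linarith
    moreover have "cf q \<in> Pi_deg j"
      using lead_below_triangle_iff[OF q(1), of j] q(2) by (simp add: below_triangle_iff)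
    moreover have "cf q \<noteq> (\<lambda>_. 0)" using q(1) by (auto simp: lead_def)
    ultimately show ?thesis
      using total_degree_cf[OF q(1)] q(2) by (intro exI[of _ "cf q"]) (simp add: ev_eq_peval)
  qed
  moreover have "\<exists>S. finite S \<and> S \<subseteq> vanishing k X \<and> lin_indep S \<and> card S = 7"
    if c: "c \<in> Pi_deg j" "c \<noteq> (\<lambda>_. 0)" "card {A \<in> X. peval c A \<noteq> 0} = 3" for c
  proof -
    obtain q where q: "cf q = c" using c(1) by (rule ex_cf_of_Pi_deg)
    have "q \<noteq> 0" using c(2) q by auto
    have qj: "q \<in> below (triangle (Suc j))" using c(1) q by (simp add: below_triangle_iff)
    \<comment> \<open>Cubics vanishing at the three nodes off the curve have dimension at least 10 -
      3 = 7, and multiplied by \<open>q\<close> they vanish on all of \<open>X\<close>.\<close>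
    define Z where "Z = {A \<in> X. ev q A \<noteq> 0}"
    have Z: "finite Z" "card Z = 3" using assms(3) c(3) by (simp_all add: Z_def ev_eq_peval q)
    let ?W = "vanish Z \<inter> below (triangle (Suc 3))"
    have "7 \<le> card (leads ?W)"
      using card_leads_vanish_ge[OF Z(1), of "triangle (Suc 3)"] Z(2) by (simp add: eval_nat_numeral triangle_Suc)
    also have "\<dots> = card (leads ((*) q ` ?W))" using card_leads_mult[OF \<open>q \<noteq> 0\<close>] by simp
    also have "\<dots> \<le> card (leads ?V)"
    proof (intro card_mono leads_mono finite_leads[of _ "triangle (Suc (j + 3))"])
      show "(*) q ` ?W \<subseteq> ?V"
      proof
        fix v assume "v \<in> (*) q ` ?W"
        then obtain c where c: "v = q * c" "c \<in> vanish Z" "c \<in> below (triangle (Suc 3))" by blast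
        have "ev q A * ev c A = 0" if "A \<in> X" for A
          using c(2) that unfolding vanish_def Z_def mult_eq_0_iff by blast
        then show "v \<in> ?V" using mult_below_triangle[OF qj c(3)] by (simp add: c(1) vanish_def)
      qed
    qed auto
    finally show ?thesis using ex_lin_indep[of 7 X k] unfolding k by metis
  qed
  ultimately show ?thesis using upper unfolding j_def[symmetric] by blast
qed

end
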